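(* Let $\Omega\subset\mathbb{R}^d$ be a non-empty open set with finite Lebesgue measure $|\Omega|<\infty$. Assume that for some $\alpha\in(0,1)$ there exists $C>0$ such that $h(\lambda r)\le C\lambda^{-\alpha}h(r)$ for all $0<\lambda\le1$ and $0<r<1$. Let $n\ge2$ be an integer. If $n\alpha<1$, then $$\lim_{t\to0^+}t^{-n}\left(H(t)-t\,\mathrm{Per}_\nu(\Omega)+\sum_{k=2}^{n-1}\frac{t^k}{k!}\mathcal{L}^kg_\Omega(0)\right)=-\frac{1}{n!}\mathcal{L}^ng_\Omega(0).$$
   Context: Let $d\in\mathbb{N}$, $d\ge1$. Let $\nu$ be a Borel measure on $\mathbb{R}^d$ with $\nu(\{0\})=0$ and $\int_{\mathbb{R}^d}(1\wedge|z|)\,\nu(dz)<\infty$. Put $\psi(\xi)=\int_{\mathbb{R}^d}(1-e^{i\langle\xi,z\rangle})\,\nu(dz)$, and let $(p_t)_{t\ge0}$ be the convolution semigroup of probability measures on $\mathbb{R}^d$ with $\int_{\mathbb{R}^d}e^{i\langle\xi,x\rangle}p_t(dx)=e^{-t\psi(\xi)}$. The concentration function is $h(r)=\int_{\mathbb{R}^d}\left(1\wedge\frac{|x|^2}{r^2}\right)\nu(dx)$, $r>0$. $\mathcal{C}_0(\mathbb{R}^d)$ is the space of continuous functions $f:\mathbb{R}^d\to\mathbb{R}$ vanishing at infinity. $P_tf(x)=\int_{\mathbb{R}^d}f(x+y)\,p_t(dy)$ defines a semigroup of operators on $\mathcal{C}_0(\mathbb{R}^d)$, and $\mathcal{L}$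 is its infinitesimal generator, $\mathcal{L}f(x)=\lim_{t\to0^+}(P_tf(x)-f(x))/t$, for functions for which the limit exists. $\mathcal{L}^k$ is the $k$-fold iterate. If $\int_{|y|<1}|y|^\beta\nu(dy)<\infty$ for some $\beta\in(0,1]$ and $f\in\mathcal{C}_0(\mathbb{R}^d)$ satisfies $\sup_{0<|x-y|\le1}|f(x)-f(y)|/|x-y|^\beta<\infty$, then $\mathcal{L}f(x)=\int_{\mathbb{R}^d}(f(x+y)-f(x))\,\nu(dy)$. $|\cdot|$ of a set is Lebesgue measure. $g_\Omega(y)=|\Omega\cap(\Omega+y)|$, $y\in\mathbb{R}^d$, is the covariance function of $\Omega$, and $\mathcal{L}^kg_\Omega(0)$ means $(\mathcal{L}^kg_\Omega)(0)$. $H(t)=\int_\Omega\int_{\Omega^c-x}p_t(dy)\,dx$ (so the heat content $H_\Omega(t)=\int_\Omega\int_{\Omega-x}p_t(dy)\,dx$ equals $|\Omega|-H(t)$). $\mathrm{Per}_\nu(\Omega)=\int_\Omega\int_{\Omega^c-x}\nu(dy)\,dx$ is the nonlocal perimeter related to $\nu$. An empty sum is $0$.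
   Formalization: As stated, Per_ν(Ω) may be infinite and L^k g_Ω undefined. The limit (and Per_ν(Ω)<∞) is proved whenever g_Ω lies in the domain of L^n, L being the generator on C_0 (sup-norm limits); membership is proved when g_Ω is Lipschitz. *)

theory Defs
  imports "HOL-Probability.Probability"
begin

definition finite_variation_levy_measure :: "(real ^ 'd) measure \<Rightarrow> bool" where
  "finite_variation_levy_measure \<nu> \<longleftrightarrow>
     sets \<nu> = sets borel \<and> emeasure \<nu> {0} = 0 \<and> integrable \<nu> (\<lambda>z. min 1 (norm z))"

definition char_exponent :: "(real ^ 'd) measure \<Rightarrow> real ^ 'd \<Rightarrow> complex" where
  "char_exponent \<nu> \<xi> = (CLINT z|\<nu>. 1 - iexp (\<xi> \<bullet> z))"

definition concentration :: "(real ^ 'd) measure \<Rightarrow> real \<Rightarrow> real" where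
  "concentration \<nu> r = (LINT x|\<nu>. min 1 ((norm x)\<^sup>2 / r\<^sup>2))"

text \<open>The family is indexed by all reals; only the members with index \<open>t \<ge> 0\<close> matter.\<close>

definition convolution_semigroup :: "(real \<Rightarrow> (real ^ 'd) measure) \<Rightarrow> bool" where
  "convolution_semigroup p \<longleftrightarrow>
     (\<forall>t\<ge>0. prob_space (p t) \<and> sets (p t) = sets borel) \<and>
     p 0 = return borel 0 \<and>
     (\<forall>s\<ge>0. \<forall>t\<ge>0. p s \<star> p t = p (s + t)) \<and>
     (\<forall>f :: real ^ 'd \<Rightarrow> real. continuous_on UNIV f \<longrightarrow> bounded (range f) \<longrightarrow>
        ((\<lambda>t. LINT x|p t. f x) \<longlongrightarrow> f 0) (at_right 0))"

definition semigroup_with_exponent ::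
    "(real \<Rightarrow> (real ^ 'd) measure) \<Rightarrow> (real ^ 'd \<Rightarrow> complex) \<Rightarrow> bool" where
  "semigroup_with_exponent p \<psi> \<longleftrightarrow>
     convolution_semigroup p \<and>
     (\<forall>t\<ge>0. \<forall>\<xi>. (CLINT x|p t. iexp (\<xi> \<bullet> x)) = exp (- complex_of_real t * \<psi> \<xi>))"

definition C0 :: "(real ^ 'd \<Rightarrow> real) set" where
  "C0 = {f. continuous_on UNIV f \<and> (f \<longlongrightarrow> 0) at_infinity}"

definition transition ::
    "(real \<Rightarrow> (real ^ 'd) measure) \<Rightarrow> real \<Rightarrow> (real ^ 'd \<Rightarrow> real) \<Rightarrow> real ^ 'd \<Rightarrow> real" where
  "transition p t f x = (LINT y|p t. f (x + y))"

definition generator ::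
    "(real \<Rightarrow> (real ^ 'd) measure) \<Rightarrow> (real ^ 'd \<Rightarrow> real) \<Rightarrow> real ^ 'd \<Rightarrow> real" where
  "generator p f x = Lim (at_right 0) (\<lambda>t. (transition p t f x - f x) / t)"

text \<open>
  \<open>Lim\<close> is an arbitrary value where the limit does not exist, so \<open>generator p f\<close> is
  meaningful only for \<open>f\<close> in the domain: those \<open>f\<close> in \<open>C0\<close> whose difference quotients
  converge in the supremum norm to an element of \<open>C0\<close>.  Its iterate \<open>(generator p ^^ n) f\<close>
  is meaningful for \<open>f \<in> generator_domain_pow p n\<close>.
\<close>

definition generator_domain ::
    "(real \<Rightarrow> (real ^ 'd) measure) \<Rightarrow> (real ^ 'd \<Rightarrow> real) set" where
  "generator_domain p =
     {f \<in> C0. \<exists>u\<in>C0. uniform_limit UNIV (\<lambda>t x. (transition p t f x - f x) / t) u (at_right 0)}"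

definition generator_domain_pow ::
    "(real \<Rightarrow> (real ^ 'd) measure) \<Rightarrow> nat \<Rightarrow> (real ^ 'd \<Rightarrow> real) set" where
  "generator_domain_pow p n = {f \<in> C0. \<forall>k<n. (generator p ^^ k) f \<in> generator_domain p}"

definition covariance :: "(real ^ 'd) set \<Rightarrow> real ^ 'd \<Rightarrow> real" where
  "covariance \<Omega> y = measure lborel (\<Omega> \<inter> (\<lambda>x. x + y) ` \<Omega>)"

definition heat_loss ::
    "(real \<Rightarrow> (real ^ 'd) measure) \<Rightarrow> (real ^ 'd) set \<Rightarrow> real \<Rightarrow> real" where
  "heat_loss p \<Omega> t = (LINT x:\<Omega>|lborel. measure (p t) ((\<lambda>z. z - x) ` (- \<Omega>)))"

text \<open>The nonlocal perimeter may be infinite.\<close>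

definition nonlocal_perimeter :: "(real ^ 'd) measure \<Rightarrow> (real ^ 'd) set \<Rightarrow> ennreal" where
  "nonlocal_perimeter \<nu> \<Omega> = (\<integral>\<^sup>+x\<in>\<Omega>. emeasure \<nu> ((\<lambda>z. z - x) ` (- \<Omega>)) \<partial>lborel)"

end

theory Submission
  imports Defs
begin

text \<open>
  Write \<open>g\<close> for the covariance function of \<open>\<Omega>\<close>, \<open>P\<^sub>t\<close> for the semigroup and \<open>\<L>\<close> for its generator.
  Exchanging the order of integration turns the heat loss into \<open>g(0) - P\<^sub>t g(0)\<close> (\<open>heat_loss_eq\<close>)
  and the perimeter into \<open>\<integral> (g(0) - g(y)) \<nu>(dy)\<close> (\<open>nonlocal_perimeter_eq\<close>). The asserted limit is
  therefore Taylor's formula of order \<open>n\<close> for \<open>t \<mapsto> P\<^sub>t g(0)\<close> at \<open>t = 0\<close> (\<open>transition_Taylor\<close>), once the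
  coefficient of \<open>t\<close> is recognised as minus the perimeter: \<open>\<L>g(0) = \<integral> (g(y) - g(0)) \<nu>(dy)\<close>.

  Both this identity and the statement on Lipschitz covariance functions rest on one criterion
  (\<open>generates_jump_integral\<close>): if \<open>f \<in> C\<^sub>0\<close> satisfies \<open>\<bar>f(x + y) - f(x)\<bar> \<le> w(y)\<close> for all \<open>x, y\<close> with a
  \<open>\<nu>\<close>-integrable \<open>w\<close>, then \<open>f\<close> is in the domain and \<open>\<L>f(x) = \<integral> (f(x + y) - f(x)) \<nu>(dy)\<close>. Since
  \<open>p\<^sub>t\<close> and \<open>\<nu>\<close> are linked by characteristic functions only, the criterion is first proved for
  superpositions of characters (\<open>spectral_generates\<close>). A general \<open>f\<close> is made integrable by cutting off
  small values and then smoothed by a Gaussian, which yields such a superposition. Both operations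
  keep the modulus \<open>w\<close>, so the jump integrals converge by dominated convergence, and the generator is
  closed.

  For the identity: \<open>\<bar>g(x + y) - g(x)\<bar> \<le> g(0) - g(y)\<close>, hence the criterion applies to \<open>g\<close> as soon
  as the perimeter is finite. Finiteness follows from \<open>g\<close> being in the domain and having its maximum
  at \<open>0\<close> (\<open>integrable_drop_from_maximum\<close>).

  For Lipschitz \<open>g\<close>: the scaling of the concentration function gives \<open>\<nu>(\<bar>z\<bar> \<ge> r) \<le> K r\<^sup>-\<^sup>\<alpha>\<close> for
  \<open>r \<le> 1\<close>. Consequently \<open>\<L>\<close> is defined on \<open>\<beta>\<close>-Hoelder functions in \<open>C\<^sub>0\<close> for \<open>\<beta> > \<alpha>\<close> and lowers the
  exponent by \<open>\<alpha>\<close> (\<open>holder_generator\<close>). Starting at exponent \<open>1\<close>, this can be repeated \<open>n\<close> times when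
  \<open>n\<alpha> < 1\<close>.
\<close>

section \<open>Averaging operators on the space of continuous functions vanishing at infinity\<close>

lemma C0_bounded:
  fixes f :: "real ^ 'd \<Rightarrow> real"
  assumes "f \<in> C0"
  obtains B where "\<And>x. \<bar>f x\<bar> \<le> B" "0 \<le> B"
proof -
  have cont: "continuous_on UNIV f" and lim: "(f \<longlongrightarrow> 0) at_infinity"
    using assms by (auto simp: C0_def)
  from tendstoD[OF lim, of 1] obtain R where R: "\<And>x. R \<le> norm x \<Longrightarrow> \<bar>f x\<bar> < 1"
    by (auto simp: eventually_at_infinity)
  have "compact (f ` cball 0 R)"
    using cont by (intro compact_continuous_image) (auto intro: continuous_on_subset)
  then obtain B where B: "\<And>x. norm x \<le> R \<Longrightarrow> \<bar>f x\<bar> \<le> B"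
    by (fastforce dest!: compact_imp_bounded simp: bounded_iff)
  have "\<bar>f x\<bar> \<le> max 1 B" for x
    using B[of x] R[of x] by linarith
  then show thesis by (intro that[of "max 1 B"]) auto
qed

lemma C0_measurable: "f \<in> C0 \<Longrightarrow> f \<in> borel_measurable borel"
  by (auto simp: C0_def intro: borel_measurable_continuous_onI)

lemma C0_uniformly_continuous:
  fixes f :: "real ^ 'd \<Rightarrow> real"
  assumes "f \<in> C0"
  shows "uniformly_continuous_on UNIV f"
  unfolding uniformly_continuous_on_def
proof (intro allI impI)
  fix e :: real
  assume e: "0 < e"
  have cont: "continuous_on UNIV f" and lim: "(f \<longlongrightarrow> 0) at_infinity"
    using assms by (auto simp: C0_def)
  from tendstoD[OF lim, of "e/2"] e obtain R where R: "\<And>x. R \<le> norm x \<Longrightarrow> \<bar>f x\<bar> < e/2"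
    by (auto simp: eventually_at_infinity)
  have "uniformly_continuous_on (cball 0 (R + 1)) f"
    using cont by (intro compact_uniformly_continuous) (auto intro: continuous_on_subset)
  then obtain d where d: "d > 0"
    "\<And>x y. norm x \<le> R + 1 \<Longrightarrow> norm y \<le> R + 1 \<Longrightarrow> dist y x < d \<Longrightarrow> dist (f y) (f x) < e"
    using e unfolding uniformly_continuous_on_def by (metis mem_cball_0)
  show "\<exists>d>0. \<forall>x\<in>UNIV. \<forall>x'\<in>UNIV. dist x' x < d \<longrightarrow> dist (f x') (f x) < e"
  proof (intro exI[of _ "min d 1"] conjI ballI impI)
    fix x y :: "real ^ 'd"
    assume xy: "dist y x < min d 1"
    have *: "norm x \<le> norm y + dist y x" "norm y \<le> norm x + dist y x"
      by norm+
    show "dist (f y) (f x) < e"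
    proof (cases "norm x \<le> R + 1 \<and> norm y \<le> R + 1")
      case True
      then show ?thesis using d xy by auto
    next
      case False
      then have "R \<le> norm x" "R \<le> norm y" using * xy by auto
      with R[of x] R[of y] show ?thesis by (auto simp: dist_real_def)
    qed
  qed (use d in auto)
qed

lemma C0_uniform_limit:
  fixes f :: "'i \<Rightarrow> real ^ 'd \<Rightarrow> real"
  assumes "\<forall>\<^sub>F k in F. f k \<in> C0" "uniform_limit UNIV f g F" "F \<noteq> bot"
  shows "g \<in> C0"
proof -
  have "continuous_on UNIV g"
    using assms by (intro uniform_limit_theorem[of _ f F]) (auto simp: C0_def elim: eventually_mono)
  moreover have "(g \<longlongrightarrow> 0) at_infinity"
  proof (rule tendstoI)
    fix e :: real
    assume e: "0 < e"
    have "\<forall>\<^sub>F k in F. f k \<in> C0 \<and> (\<forall>x. dist (f k x) (g x) < e / 2)"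
      using assms(1) uniform_limitD[OF assms(2), of "e/2"] e by (auto simp: eventually_conj_iff)
    then obtain k where k: "f k \<in> C0" "\<And>x. dist (f k x) (g x) < e / 2"
      using assms(3) eventually_happens' by blast
    then have "(f k \<longlongrightarrow> 0) at_infinity" by (auto simp: C0_def)
    from tendstoD[OF this, of "e/2"] e have "\<forall>\<^sub>F x in at_infinity. dist (f k x) 0 < e/2" by simp
    then show "\<forall>\<^sub>F x in at_infinity. dist (g x) 0 < e"
    proof eventually_elim
      case (elim x)
      then show ?case using k(2)[of x] unfolding dist_real_def by arith
    qed
  qed
  ultimately show ?thesis by (auto simp: C0_def)
qed

lemma C0_diff: "f \<in> C0 \<Longrightarrow> g \<in> C0 \<Longrightarrow> (\<lambda>x. f x - g x) \<in> C0"
  by (auto simp: C0_def intro!: continuous_intros tendsto_eq_intros)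

lemma C0_cmult: "f \<in> C0 \<Longrightarrow> (\<lambda>x. c * f x) \<in> C0"
  by (auto simp: C0_def intro!: continuous_intros tendsto_eq_intros)

definition average :: "(real ^ 'd) measure \<Rightarrow> (real ^ 'd \<Rightarrow> real) \<Rightarrow> real ^ 'd \<Rightarrow> real" where
  "average \<mu> f x = (LINT y|\<mu>. f (x + y))"

lemma transition_eq_average: "transition p t = average (p t)"
  by (auto simp: fun_eq_iff transition_def average_def)

abbreviation borel_prob :: "(real ^ 'd) measure \<Rightarrow> bool" where
  "borel_prob \<mu> \<equiv> prob_space \<mu> \<and> sets \<mu> = sets borel"

lemma borel_prob_integrable_bounded:
  fixes f :: "real ^ 'd \<Rightarrow> real"
  assumes "borel_prob \<mu>" "f \<in> borel_measurable borel" "\<And>x. \<bar>f x\<bar> \<le> B"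
  shows "integrable \<mu> f"
proof -
  interpret prob_space \<mu> using assms by blast
  have [measurable_cong]: "sets \<mu> = sets borel" using assms by blast
  show ?thesis
    using assms by (intro integrable_const_bound[of _ B]) auto
qed

lemma shift_C0:
  assumes "f \<in> C0" shows "(\<lambda>y. f (x + y)) \<in> C0"
proof -
  have "filterlim (\<lambda>y. x + y) at_infinity at_infinity"
    by (intro tendsto_add_filterlim_at_infinity[of _ x]) (auto intro: filterlim_ident)
  then have "((\<lambda>y. f (x + y)) \<longlongrightarrow> 0) at_infinity"
    using assms unfolding C0_def by (auto elim!: filterlim_compose)
  moreover have "continuous_on UNIV (\<lambda>y. f (x + y))"
    using assms unfolding C0_def
    by (auto intro!: continuous_intros intro: continuous_on_compose2)
  ultimately show ?thesis by (auto simp: C0_def)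
qed

lemma C0_shift_integrable:
  assumes "borel_prob \<mu>" "f \<in> C0"
  shows "integrable \<mu> (\<lambda>y. f (x + y))"
proof -
  have g: "(\<lambda>y. f (x + y)) \<in> C0" using assms shift_C0 by blast
  then obtain B where "\<And>y. \<bar>f (x + y)\<bar> \<le> B" by (rule C0_bounded) auto
  then show ?thesis using assms C0_measurable[OF g] by (intro borel_prob_integrable_bounded) auto
qed

lemma average_bound:
  assumes "borel_prob \<mu>" "f \<in> borel_measurable borel" "\<And>x. \<bar>f x\<bar> \<le> B"
  shows "\<bar>average \<mu> f x\<bar> \<le> B"
proof -
  interpret prob_space \<mu> using assms by blast
  have "(\<lambda>y. f (x + y)) \<in> borel_measurable borel" using assms(2) by measurable
  then have "integrable \<mu> (\<lambda>y. f (x + y))"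
    using assms by (intro borel_prob_integrable_bounded) auto
  then have "\<bar>average \<mu> f x\<bar> \<le> (\<integral>y. \<bar>f (x + y)\<bar> \<partial>\<mu>)" unfolding average_def by auto
  also have "\<dots> \<le> (\<integral>y. B \<partial>\<mu>)" by (intro integral_mono) (use assms \<open>integrable \<mu> _\<close> in auto)
  finally show ?thesis by (simp add: prob_space)
qed

lemma average_diff:
  assumes "borel_prob \<mu>" "f \<in> C0" "g \<in> C0"
  shows "average \<mu> (\<lambda>x. f x - g x) x = average \<mu> f x - average \<mu> g x"
  unfolding average_def
  using assms by (intro Bochner_Integration.integral_diff C0_shift_integrable)

lemma average_cmult: "average \<mu> (\<lambda>x. c * f x) x = c * average \<mu> f x"
  by (simp add: average_def)

lemma average_diff_bound:
  assumes "borel_prob \<mu>" "f \<in> C0" "g \<in> C0" "\<And>x. \<bar>f x - g x\<bar> \<le> B"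
  shows "\<bar>average \<mu> f x - average \<mu> g x\<bar> \<le> B"
  using average_bound[OF assms(1) C0_measurable[OF C0_diff[OF assms(2,3)]] assms(4), of x]
  by (simp add: average_diff[OF assms(1-3)])

lemma average_modulus:
  assumes "borel_prob \<mu>" "f \<in> C0" "\<And>x. \<bar>f (x + y) - f x\<bar> \<le> B"
  shows "\<bar>average \<mu> f (x + y) - average \<mu> f x\<bar> \<le> B"
proof -
  have "average \<mu> f (x + y) = average \<mu> (\<lambda>z. f (y + z)) x"
    by (simp add: average_def add_ac)
  then show ?thesis
    using average_diff_bound[OF assms(1) shift_C0[OF assms(2), of y] assms(2), of B x] assms(3)
    by (simp add: add_ac)
qed

text \<open>
  Continuity is dominated convergence. For the decay at infinity, all but a small part of the mass of
  \<open>\<mu>\<close> lies in a ball, and translating by a point of that ball keeps a far away argument far away.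
\<close>

lemma average_C0:
  fixes f :: "real ^ 'd \<Rightarrow> real"
  assumes \<mu>: "borel_prob \<mu>" and f: "f \<in> C0"
  shows "average \<mu> f \<in> C0"
proof -
  interpret prob_space \<mu> using \<mu> by blast
  have [measurable_cong]: "sets \<mu> = sets borel" using \<mu> by blast
  have [measurable]: "f \<in> borel_measurable borel" by (rule C0_measurable[OF f])
  obtain B where B: "\<And>x. \<bar>f x\<bar> \<le> B" "0 \<le> B" using f by (rule C0_bounded) auto
  have cont: "isCont f x" for x
    using f by (auto simp: C0_def continuous_on_eq_continuous_at)
  have "continuous_on UNIV (average \<mu> f)"
  proof (rule continuous_on_sequentiallyI)
    fix u :: "nat \<Rightarrow> real ^ 'd" and a assume u: "u \<longlonglongrightarrow> a"
    show "(\<lambda>n. average \<mu> f (u n)) \<longlonglongrightarrow> average \<mu> f a"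
      unfolding average_def
    proof (rule integral_dominated_convergence[where w = "\<lambda>_. B"])
      show "AE y in \<mu>. (\<lambda>n. f (u n + y)) \<longlonglongrightarrow> f (a + y)"
        using u by (intro AE_I2 isCont_tendsto_compose[OF cont] tendsto_intros)
    qed (use B in auto)
  qed
  moreover have "(average \<mu> f \<longlongrightarrow> 0) at_infinity"
  proof (rule tendstoI)
    fix e :: real assume e: "0 < e"
    define S where "S n = {y \<in> space \<mu>. real n \<le> norm y}" for n
    have Sm[measurable]: "S n \<in> sets \<mu>" for n by (simp add: S_def)
    have intS: "integrable \<mu> (\<lambda>y. e / 2 + B * indicator (S n) y)" for n
      by (intro Bochner_Integration.integrable_add integrable_mult_right integrable_real_indicator)
        (simp_all add: Sm less_top[symmetric])
    have "(\<lambda>n. measure \<mu> (S n)) \<longlonglongrightarrow> measure \<mu> (\<Inter>n. S n)"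
      by (intro finite_Lim_measure_decseq) (use Sm in \<open>auto simp: S_def decseq_def\<close>)
    moreover have "(\<Inter>n. S n) = {}"
    proof -
      have "y \<notin> (\<Inter>n. S n)" for y
      proof -
        obtain m :: nat where "norm y < real m" using reals_Archimedean2 by blast
        then have "y \<notin> S m" by (simp add: S_def)
        then show ?thesis by blast
      qed
      then show ?thesis by blast
    qed
    ultimately have "(\<lambda>n. B * measure \<mu> (S n)) \<longlonglongrightarrow> 0" by (auto intro!: tendsto_eq_intros)
    then have "\<forall>\<^sub>F n in sequentially. B * measure \<mu> (S n) < e / 2"
      using e by (intro order_tendstoD(2)[of _ 0]) auto
    then obtain n where n: "B * measure \<mu> (S n) < e / 2"
      by (auto simp: eventually_sequentially)
    have "(f \<longlongrightarrow> 0) at_infinity" using f by (auto simp: C0_def)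
    from tendstoD[OF this, of "e/2"] e obtain R where R: "\<And>x. R \<le> norm x \<Longrightarrow> \<bar>f x\<bar> < e/2"
      by (auto simp: eventually_at_infinity)
    have "\<bar>average \<mu> f x\<bar> < e" if x: "R + real n \<le> norm x" for x
    proof -
      have "\<bar>f (x + y)\<bar> \<le> e / 2 + B * indicator (S n) y" if "y \<in> space \<mu>" for y
      proof (cases "y \<in> S n")
        case True
        then show ?thesis using B(1)[of "x + y"] e by auto
      next
        case False
        then have "norm y < n" using that by (auto simp: S_def)
        then have "R \<le> norm (x + y)" using x norm_diff_ineq[of x y] by linarith
        then show ?thesis using R[of "x+y"] False by auto
      qed
      then have "(\<integral>y. \<bar>f (x + y)\<bar> \<partial>\<mu>) \<le> (\<integral>y. e / 2 + B * indicator (S n) y \<partial>\<mu>)"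
        using C0_shift_integrable[OF \<mu> f, of x] intS by (intro integral_mono) simp_all
      also have "\<dots> = e / 2 + B * measure \<mu> (S n)"
        by (subst Bochner_Integration.integral_add)
          (simp_all add: Sm prob_space integrable_real_indicator less_top[symmetric])
      finally have "(\<integral>y. \<bar>f (x + y)\<bar> \<partial>\<mu>) < e" using n by linarith
      moreover have "\<bar>average \<mu> f x\<bar> \<le> (\<integral>y. \<bar>f (x + y)\<bar> \<partial>\<mu>)"
        using C0_shift_integrable[OF \<mu> f] unfolding average_def by auto
      ultimately show ?thesis by linarith
    qed
    then show "\<forall>\<^sub>F x in at_infinity. dist (average \<mu> f x) 0 < e"
      by (auto simp: eventually_at_infinity intro!: exI[of _ "R + real n"])
  qed
  ultimately show ?thesis by (auto simp: C0_def)
qed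

text \<open>
  The mean of \<open>1 \<and> \<bar>y\<bar>\<close> measures how far \<open>\<mu>\<close> is from the point mass at \<open>0\<close>. Beyond the radius given by
  uniform continuity it dominates the increments of the bounded function \<open>f\<close>.
\<close>

lemma average_approximate_identity:
  fixes f :: "real ^ 'd \<Rightarrow> real" and \<mu> :: "'i \<Rightarrow> (real ^ 'd) measure"
  assumes f: "f \<in> C0" and \<mu>: "\<forall>\<^sub>F k in F. borel_prob (\<mu> k)"
    and small: "((\<lambda>k. LINT y|\<mu> k. min 1 (norm y)) \<longlongrightarrow> 0) F"
  shows "uniform_limit UNIV (\<lambda>k. average (\<mu> k) f) f F"
proof (rule uniform_limitI)
  fix e :: real assume e: "0 < e"
  obtain B where B: "\<And>x. \<bar>f x\<bar> \<le> B" "0 \<le> B" using f by (rule C0_bounded) auto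
  obtain d where d: "d > 0" "\<And>x y. dist y x < d \<Longrightarrow> dist (f y) (f x) < e / 2"
    using C0_uniformly_continuous[OF f] e unfolding uniformly_continuous_on_def
    by (metis UNIV_I half_gt_zero)
  define d' where "d' = min d 1"
  have d': "d' > 0" "d' \<le> d" "d' \<le> 1" using d by (auto simp: d'_def)
  have "((\<lambda>k. (2 * B / d') * (LINT y|\<mu> k. min 1 (norm y))) \<longlongrightarrow> (2 * B / d') * 0) F"
    by (intro tendsto_intros small)
  then have "\<forall>\<^sub>F k in F. (2 * B / d') * (LINT y|\<mu> k. min 1 (norm y)) < e / 2"
    using e by (intro order_tendstoD(2)) auto
  with \<mu> show "\<forall>\<^sub>F k in F. \<forall>x\<in>UNIV. dist (average (\<mu> k) f x) (f x) < e"
  proof eventually_elim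
    case (elim k)
    interpret prob_space "\<mu> k" using elim by blast
    have [measurable_cong]: "sets (\<mu> k) = sets borel" using elim by blast
    have int: "integrable (\<mu> k) (\<lambda>y. min 1 (norm y))"
      using elim by (intro borel_prob_integrable_bounded[where B = 1]) auto
    show ?case
    proof
      fix x
      have intd: "integrable (\<mu> k) (\<lambda>y. f (x + y) - f x)"
        using C0_shift_integrable[of "\<mu> k" f x] elim f by auto
      have *: "\<bar>f (x + y) - f x\<bar> \<le> e / 2 + (2 * B / d') * min 1 (norm y)" for y
      proof (cases "norm y < d'")
        case True
        then have "\<bar>f (x + y) - f x\<bar> < e / 2" using d(2)[of "x + y" x] d' by (auto simp: dist_norm)
        moreover have "0 \<le> (2 * B / d') * min 1 (norm y)" using B d' by auto
        ultimately show ?thesis by linarith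
      next
        case False
        then have "d' \<le> min 1 (norm y)" using d' by auto
        then have "2 * B \<le> (2 * B / d') * min 1 (norm y)"
          using d' B by (simp add: field_simps mult_left_mono)
        then show ?thesis using B(1)[of x] B(1)[of "x + y"] e by (auto simp: abs_le_iff)
      qed
      have "average (\<mu> k) f x - f x = (\<integral>y. f (x + y) - f x \<partial>\<mu> k)"
        using C0_shift_integrable[of "\<mu> k" f x] elim f
        by (subst Bochner_Integration.integral_diff) (simp_all add: average_def prob_space)
      also have "\<bar>\<dots>\<bar> \<le> (\<integral>y. \<bar>f (x + y) - f x\<bar> \<partial>\<mu> k)" using intd by auto
      also have "\<dots> \<le> (\<integral>y. e / 2 + (2 * B / d') * min 1 (norm y) \<partial>\<mu> k)"
        using * intd int by (intro integral_mono) auto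
      also have "\<dots> = e / 2 + (2 * B / d') * (\<integral>y. min 1 (norm y) \<partial>\<mu> k)"
        using int by (subst Bochner_Integration.integral_add) (auto simp: prob_space)
      also have "\<dots> < e" using elim by linarith
      finally show "dist (average (\<mu> k) f x) (f x) < e" by (simp add: dist_real_def)
    qed
  qed
qed

section \<open>Semigroup calculus\<close>

lemma convolution_semigroup_prob: "convolution_semigroup p \<Longrightarrow> 0 \<le> t \<Longrightarrow> borel_prob (p t)"
  by (auto simp: convolution_semigroup_def)

lemma transition_0:
  assumes "convolution_semigroup p" "f \<in> C0"
  shows "transition p 0 f = f"
  using assms C0_measurable[of f]
  by (auto simp: convolution_semigroup_def transition_def integral_return)

lemma transition_C0:
  "convolution_semigroup p \<Longrightarrow> 0 \<le> t \<Longrightarrow> f \<in> C0 \<Longrightarrow> transition p t f \<in> C0"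
  by (simp add: transition_eq_average average_C0 convolution_semigroup_prob)

lemma transition_add:
  assumes p: "convolution_semigroup p" and f: "f \<in> C0" and st: "0 \<le> s" "0 \<le> t"
  shows "transition p (s + t) f x = transition p s (transition p t f) x"
proof -
  note ps = convolution_semigroup_prob[OF p st(1)] and pt = convolution_semigroup_prob[OF p st(2)]
  have [measurable]: "f \<in> borel_measurable borel" by (rule C0_measurable[OF f])
  interpret S: prob_space "p s" using ps by blast
  interpret T: prob_space "p t" using pt by blast
  interpret ST: pair_prob_space "p s" "p t" ..
  have [measurable_cong]: "sets (p s) = sets borel" "sets (p t) = sets borel"
    using ps pt by auto
  obtain B where B: "\<And>x. \<bar>f x\<bar> \<le> B" "0 \<le> B" using f by (rule C0_bounded) auto
  have "transition p (s + t) f x = (LINT w|(p s \<star> p t). f (x + w))"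
    using p st by (simp add: convolution_semigroup_def transition_def)
  also have "\<dots> = (LINT w|(p s \<Otimes>\<^sub>M p t). f (x + (fst w + snd w)))"
    unfolding convolution_def by (subst integral_distr) (auto simp: case_prod_beta)
  also have "\<dots> = (LINT y|p s. LINT z|p t. f (x + (y + z)))"
    by (subst ST.integral_fst'[symmetric])
      (auto intro!: ST.P.integrable_const_bound[of _ B] simp: B)
  finally show ?thesis by (simp add: transition_def add_ac)
qed

lemma transition_strongly_continuous:
  assumes p: "convolution_semigroup p" and f: "f \<in> C0"
  shows "uniform_limit UNIV (\<lambda>t. transition p t f) f (at_right 0)"
  unfolding transition_eq_average
proof (rule average_approximate_identity[OF f])
  show "\<forall>\<^sub>F t in at_right 0. borel_prob (p t)"
    using eventually_at_right_less[of 0]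
    by eventually_elim (auto simp: convolution_semigroup_prob[OF p])
  have "continuous_on UNIV (\<lambda>y::real ^ 'a. min 1 (norm y))"
    by (intro continuous_intros)
  moreover have "bounded (range (\<lambda>y::real ^ 'a. min 1 (norm y)))"
    by (intro boundedI[of _ 1]) auto
  ultimately have "((\<lambda>t. LINT y|p t. min 1 (norm y)) \<longlongrightarrow> min 1 (norm (0 :: real ^ 'a))) (at_right 0)"
    using p unfolding convolution_semigroup_def by blast
  then show "((\<lambda>t. LINT y|p t. min 1 (norm y)) \<longlongrightarrow> 0) (at_right 0)" by simp
qed

text \<open>
  The graph of the generator. In contrast to the generator itself, which is a pointwise limit with a
  default value, it says that \<open>f\<close> is in the domain.
\<close>

definition generates :: "(real \<Rightarrow> (real ^ 'd) measure) \<Rightarrow> (real ^ 'd \<Rightarrow> real) \<Rightarrow> (real ^ 'd \<Rightarrow> real) \<Rightarrow> bool" where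
  "generates p f u \<longleftrightarrow> f \<in> C0 \<and> u \<in> C0 \<and>
     uniform_limit UNIV (\<lambda>t x. (transition p t f x - f x) / t) u (at_right 0)"

lemma generates_generator:
  assumes "generates p f u"
  shows "generator p f = u"
proof
  fix x
  have "((\<lambda>t. (transition p t f x - f x) / t) \<longlongrightarrow> u x) (at_right 0)"
    using assms by (auto simp: generates_def intro: tendsto_uniform_limitI)
  then show "generator p f x = u x"
    unfolding generator_def by (intro tendsto_Lim) auto
qed

lemma generator_domain_generates:
  "f \<in> generator_domain p \<longleftrightarrow> generates p f (generator p f)"
proof
  assume "f \<in> generator_domain p"
  then obtain u where "generates p f u" by (auto simp: generator_domain_def generates_def)
  then show "generates p f (generator p f)" using generates_generator by metis
qed (auto simp: generator_domain_def generates_def)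

lemma transition_increment_bound:
  assumes p: "convolution_semigroup p" and u: "u \<in> C0" and st: "0 \<le> s" "0 \<le> t"
    and e: "\<And>x. \<bar>transition p \<bar>t - s\<bar> u x - u x\<bar> \<le> e"
  shows "\<bar>transition p t u x - transition p s u x\<bar> \<le> e"
proof -
  have *: "\<bar>transition p t u x - transition p s u x\<bar> \<le> e"
    if "0 \<le> s" "s \<le> t" and e: "\<And>x. \<bar>transition p (t - s) u x - u x\<bar> \<le> e" for s t
  proof -
    have "transition p t u x = transition p s (transition p (t - s) u) x"
      using transition_add[OF p u, of s "t - s" x] that by simp
    then show ?thesis
      using average_diff_bound[OF convolution_semigroup_prob[OF p that(1)] transition_C0[OF p _ u] u e, of x] that
      by (simp add: transition_eq_average)
  qed
  show ?thesis
  proof (cases "s \<le> t")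
    case True
    then show ?thesis using *[OF st(1) True] e by simp
  next
    case False
    then show ?thesis using *[OF st(2), of s] e by (simp add: abs_minus_commute)
  qed
qed

text \<open>
  For \<open>s, t \<ge> 0\<close> put \<open>m = min s t\<close> and \<open>h = \<bar>s - t\<bar>\<close>. The difference quotient between \<open>s\<close> and \<open>t\<close> is
  \<open>P\<^sub>m\<close> applied to \<open>(P\<^sub>h f - f) / h\<close>, which is uniformly close to \<open>u\<close>, and \<open>P\<^sub>m u\<close> is close to \<open>P\<^sub>t u\<close>. This
  covers the derivatives from both sides at once.
\<close>

lemma transition_has_derivative:
  assumes p: "convolution_semigroup p" and fu: "generates p f u" and t: "0 \<le> t"
  shows "((\<lambda>t. transition p t f x) has_real_derivative transition p t u x) (at t within {0..})"
  unfolding has_field_derivative_iff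
proof (rule tendstoI)
  fix e :: real assume e: "0 < e"
  have f: "f \<in> C0" and u: "u \<in> C0"
    and lim: "uniform_limit UNIV (\<lambda>t x. (transition p t f x - f x) / t) u (at_right 0)"
    using fu by (auto simp: generates_def)
  have "\<forall>\<^sub>F h in at_right 0. (\<forall>x. \<bar>(transition p h f x - f x) / h - u x\<bar> < e / 3) \<and>
      (\<forall>x. \<bar>transition p h u x - u x\<bar> < e / 3)"
    using uniform_limitD[OF lim, of "e/3"]
      uniform_limitD[OF transition_strongly_continuous[OF p u], of "e/3"] e
    by (auto simp: dist_real_def eventually_conj_iff)
  then obtain d where d: "d > 0"
    "\<And>h x. 0 < h \<Longrightarrow> h < d \<Longrightarrow> \<bar>(transition p h f x - f x) / h - u x\<bar> < e / 3"
    "\<And>h x. 0 < h \<Longrightarrow> h < d \<Longrightarrow> \<bar>transition p h u x - u x\<bar> < e / 3"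
    unfolding eventually_at_right_field by (metis)
  have key: "\<bar>(transition p s f x - transition p t f x) / (s - t) - transition p t u x\<bar> < e"
    if s: "0 \<le> s" "s \<noteq> t" "\<bar>s - t\<bar> < d" for s
  proof -
    define m where "m = min s t"
    define h where "h = \<bar>s - t\<bar>"
    have h: "0 < h" "h < d" and m: "0 \<le> m" "m + h = max s t"
      using s t by (auto simp: h_def m_def)
    have Q: "(transition p h f y - f y) / h - u y = (1 / h) * (transition p h f y - f y) - u y" for y
      by simp
    have C: "(\<lambda>y. (1 / h) * (transition p h f y - f y)) \<in> C0"
      using h by (intro C0_cmult C0_diff transition_C0[OF p] f) auto
    have "(transition p s f x - transition p t f x) / (s - t)
        = (transition p (m + h) f x - transition p m f x) / h"
      unfolding m by (auto simp: m_def h_def max_def min_def abs_if field_simps)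
    also have "\<dots> = transition p m (\<lambda>y. (1 / h) * (transition p h f y - f y)) x"
      unfolding transition_add[OF p f m(1) less_imp_le[OF h(1)]]
      unfolding transition_eq_average average_cmult
      using convolution_semigroup_prob[OF p] h m f
      by (subst average_diff) (auto intro!: average_C0)
    finally have 1: "(transition p s f x - transition p t f x) / (s - t) =
      transition p m (\<lambda>y. (1 / h) * (transition p h f y - f y)) x" .
    have 2: "\<bar>transition p m (\<lambda>y. (1 / h) * (transition p h f y - f y)) x - transition p m u x\<bar> \<le> e / 3"
      unfolding transition_eq_average
      using d(2)[OF h] unfolding Q
      by (intro average_diff_bound convolution_semigroup_prob[OF p m(1)] u C[unfolded transition_eq_average])
        (auto simp: transition_eq_average intro: less_imp_le)
    have 3: "\<bar>transition p t u x - transition p m u x\<bar> \<le> e / 3"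
    proof (cases "t = m")
      case False
      then have "\<bar>t - m\<bar> = h" by (auto simp: m_def h_def min_def split: if_splits)
      then show ?thesis
        using transition_increment_bound[OF p u m(1) t, of "e/3" x] d(3)[OF h] by (auto intro: less_imp_le)
    qed (use e in auto)
    show ?thesis using 1 2 3 e by linarith
  qed
  show "\<forall>\<^sub>F s in at t within {0..}.
      dist ((transition p s f x - transition p t f x) / (s - t)) (transition p t u x) < e"
    unfolding eventually_at using d(1) key
    by (auto simp: dist_real_def)
qed

text \<open>
  The error of the first-order expansion is \<open>\<integral>\<^sub>0\<^sup>t (P\<^sub>s u - u) ds\<close>; the mean value theorem
  bounds it without integrating. Since \<open>f\<close> and \<open>u\<close> enter only through expressions
  that are continuous in the supremum norm, the bound survives uniform limits, which makes the
  generator closed.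
\<close>

lemma transition_first_order_error:
  assumes p: "convolution_semigroup p" and fu: "generates p f u" and t: "0 \<le> t"
    and e: "\<And>s. 0 \<le> s \<Longrightarrow> s \<le> t \<Longrightarrow> \<bar>transition p s u x - u x\<bar> \<le> e"
  shows "\<bar>transition p t f x - f x - t * u x\<bar> \<le> e * t"
proof -
  have "norm ((transition p t f x - t * u x) - (transition p 0 f x - 0 * u x)) \<le> e * norm (t - 0)"
  proof (rule field_differentiable_bound[where S = "{0..t}"
        and f' = "\<lambda>s. transition p s u x - u x"])
    fix s assume s: "s \<in> {0..t}"
    have "((\<lambda>t. transition p t f x) has_real_derivative transition p s u x) (at s within {0..t})"
      by (rule DERIV_subset[OF transition_has_derivative[OF p fu]]) (use s in auto)
    then show "((\<lambda>s. transition p s f x - s * u x) has_real_derivative transition p s u x - u x)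
        (at s within {0..t})"
      by (auto intro!: derivative_eq_intros)
  qed (use t e in auto)
  then show ?thesis
    using t fu transition_0[OF p] by (auto simp: generates_def algebra_simps)
qed

text \<open>
  Apply \<open>transition_first_order_error\<close> to \<open>f\<^sub>k\<close>: its right-hand side is controlled by the strong continuity
  of the semigroup at the limit \<open>v\<close> alone, up to twice the distance from \<open>u\<^sub>k\<close> to \<open>v\<close>.
\<close>

lemma generates_closed:
  assumes p: "convolution_semigroup p" and fu: "\<And>k::nat. generates p (f k) (u k)"
    and f: "uniform_limit UNIV f g sequentially" and u: "uniform_limit UNIV u v sequentially"
  shows "generates p g v"
proof -
  have g: "g \<in> C0" and v: "v \<in> C0"
    using C0_uniform_limit[OF _ f] C0_uniform_limit[OF _ u] fu by (auto simp: generates_def)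
  have uC: "u k \<in> C0" and fC: "f k \<in> C0" for k using fu by (auto simp: generates_def)
  have "uniform_limit UNIV (\<lambda>t x. (transition p t g x - g x) / t) v (at_right 0)"
  proof (rule uniform_limitI)
    fix e :: real assume e: "0 < e"
    obtain d where d: "d > 0" "\<And>h x. 0 < h \<Longrightarrow> h < d \<Longrightarrow> \<bar>transition p h v x - v x\<bar> < e / 4"
      using uniform_limitD[OF transition_strongly_continuous[OF p v], of "e/4"] e
      by (auto simp: dist_real_def eventually_at_right_field)
    have "\<bar>(transition p t g x - g x) / t - v x\<bar> < e" if t: "0 < t" "t < d" for t x
    proof -
      have "\<bar>transition p t g x - g x - t * v x\<bar> \<le> 3 * e / 4 * t"
      proof (rule tendsto_upperbound[where F = sequentially])
        have pt: "borel_prob (p t)" using convolution_semigroup_prob[OF p] t by auto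
        have "(\<lambda>k. transition p t (f k) x) \<longlonglongrightarrow> transition p t g x"
        proof (rule tendstoI)
          fix r :: real assume r: "0 < r"
          have "\<forall>\<^sub>F k in sequentially. \<forall>x. \<bar>f k x - g x\<bar> < r / 2"
            using uniform_limitD[OF f, of "r/2"] r by (auto simp: dist_real_def)
          then show "\<forall>\<^sub>F k in sequentially. dist (transition p t (f k) x) (transition p t g x) < r"
          proof eventually_elim
            case (elim k)
            then have "\<bar>average (p t) (f k) x - average (p t) g x\<bar> \<le> r / 2"
              by (intro average_diff_bound pt fC g) (auto intro: less_imp_le)
            then show ?case using r by (simp add: dist_real_def transition_eq_average)
          qed
        qed
        then show "(\<lambda>k. \<bar>transition p t (f k) x - f k x - t * u k x\<bar>)
            \<longlonglongrightarrow> \<bar>transition p t g x - g x - t * v x\<bar>"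
          by (intro tendsto_intros tendsto_uniform_limitI[OF f] tendsto_uniform_limitI[OF u]) auto
        have "\<forall>\<^sub>F k in sequentially. \<forall>x. \<bar>u k x - v x\<bar> < e / 4"
          using uniform_limitD[OF u, of "e/4"] e by (auto simp: dist_real_def)
        then show "\<forall>\<^sub>F k in sequentially. \<bar>transition p t (f k) x - f k x - t * u k x\<bar> \<le> 3 * e / 4 * t"
        proof eventually_elim
          case (elim k)
          show ?case
          proof (rule transition_first_order_error[OF p fu])
            fix s assume s: "0 \<le> s" "s \<le> t"
            have "\<bar>transition p s v x - v x\<bar> < e / 4"
              using d(2)[of s x] s t e transition_0[OF p v] by (cases "s = 0") auto
            moreover have "\<bar>transition p s (u k) x - transition p s v x\<bar> \<le> e / 4"
              unfolding transition_eq_average using elim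
              by (intro average_diff_bound convolution_semigroup_prob[OF p] s uC v) (auto intro: less_imp_le)
            moreover have "\<bar>u k x - v x\<bar> < e / 4" using elim by auto
            ultimately show "\<bar>transition p s (u k) x - u k x\<bar> \<le> 3 * e / 4" by linarith
          qed (use t in auto)
        qed
      qed simp
      moreover have "(transition p t g x - g x) / t - v x = (transition p t g x - g x - t * v x) / t"
        using t by (simp add: field_simps)
      ultimately have "\<bar>(transition p t g x - g x) / t - v x\<bar> \<le> 3 * e / 4"
        using t by (simp add: abs_divide pos_divide_le_eq)
      then show ?thesis using e by linarith
    qed
    then show "\<forall>\<^sub>F t in at_right 0. \<forall>x\<in>UNIV. dist ((transition p t g x - g x) / t) (v x) < e"
      unfolding eventually_at_right_field using d(1) by (auto simp: dist_real_def)
  qed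
  with g v show ?thesis by (simp add: generates_def)
qed

lemma generator_domain_pow_generates:
  assumes "f \<in> generator_domain_pow p n" "k < n"
  shows "generates p ((generator p ^^ k) f) ((generator p ^^ Suc k) f)"
  using assms generator_domain_generates[of "(generator p ^^ k) f" p]
  by (auto simp: generator_domain_pow_def)

text \<open>
  Taylor's formula for \<open>t \<mapsto> P\<^sub>t f(x)\<close>, by integrating the remainder once for each order: the
  remainder of order \<open>k + 1\<close> for \<open>\<L>\<^sup>j f\<close> has the remainder of order \<open>k\<close> for \<open>\<L>\<^sup>j\<^sup>+\<^sup>1 f\<close> as
  derivative.
\<close>

lemma transition_Taylor_remainder:
  assumes p: "convolution_semigroup p" and f: "f \<in> generator_domain_pow p n"
    and e: "\<And>s. 0 \<le> s \<Longrightarrow> s \<le> d \<Longrightarrow>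
      \<bar>transition p s ((generator p ^^ n) f) x - (generator p ^^ n) f x\<bar> \<le> e"
    and k: "k \<le> n" and t: "0 \<le> t" "t \<le> d"
  shows "\<bar>transition p t ((generator p ^^ (n - k)) f) x
      - (\<Sum>j\<le>k. t ^ j / fact j * (generator p ^^ (n - k + j)) f x)\<bar> \<le> e * t ^ k"
  using k t
proof (induction k arbitrary: t)
  case 0
  then show ?case using e by simp
next
  case (Suc k)
  define F where "F = (generator p ^^ (n - Suc k)) f"
  have Suc_diff: "n - k = Suc (n - Suc k)" using Suc.prems by simp
  have gen: "generates p F ((generator p ^^ (n - k)) f)"
    unfolding F_def Suc_diff using Suc.prems by (intro generator_domain_pow_generates[OF f]) auto
  define R where "R s = transition p s F x
      - (\<Sum>j\<le>Suc k. s ^ j / fact j * (generator p ^^ (n - Suc k + j)) f x)" for s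
  define R' where "R' s = transition p s ((generator p ^^ (n - k)) f) x
      - (\<Sum>j\<le>k. s ^ j / fact j * (generator p ^^ (n - k + j)) f x)" for s
  have "0 \<le> e" using e[of 0] Suc.prems by (auto intro: order_trans[OF abs_ge_zero])
  have "norm (R t - R 0) \<le> (e * t ^ k) * norm (t - 0)"
  proof (rule field_differentiable_bound[where S = "{0..t}" and f' = R'])
    fix s assume s: "s \<in> {0..t}"
    have "((\<lambda>t. transition p t F x) has_real_derivative
        transition p s ((generator p ^^ (n - k)) f) x) (at s within {0..t})"
      by (rule DERIV_subset[OF transition_has_derivative[OF p gen]]) (use s in auto)
    moreover have "((\<lambda>s. \<Sum>j\<le>Suc k. s ^ j / fact j * (generator p ^^ (n - Suc k + j)) f x)
       has_real_derivative (\<Sum>j\<le>k. s ^ j / fact j * (generator p ^^ (n - k + j)) f x)) (at s within {0..t})"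
    proof -
      have "(\<lambda>s::real. \<Sum>j\<le>Suc k. s ^ j / fact j * (generator p ^^ (n - Suc k + j)) f x) =
        (\<lambda>s. (generator p ^^ (n - Suc k)) f x +
          (\<Sum>j\<le>k. s ^ Suc j / fact (Suc j) * (generator p ^^ (n - k + j)) f x))"
        by (subst sum.atMost_Suc_shift) (simp add: Suc_diff)
      moreover have "((\<lambda>s. s ^ Suc j / fact (Suc j) * c) has_real_derivative s ^ j / fact j * c) (at s within {0..t})"
        for j and c :: real
        by (rule derivative_eq_intros refl | simp add: field_simps del: of_nat_Suc)+
      from DERIV_add[OF DERIV_const DERIV_sum[OF this]]
      have "((\<lambda>s. (generator p ^^ (n - Suc k)) f x +
          (\<Sum>j\<le>k. s ^ Suc j / fact (Suc j) * (generator p ^^ (n - k + j)) f x)) has_real_derivative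
          0 + (\<Sum>j\<le>k. s ^ j / fact j * (generator p ^^ (n - k + j)) f x)) (at s within {0..t})" .
      ultimately show ?thesis by (simp only: add_0)
    qed
    ultimately show "(R has_real_derivative R' s) (at s within {0..t})"
      unfolding R_def[abs_def] R'_def by (rule DERIV_diff)
    have "\<bar>R' s\<bar> \<le> e * s ^ k" unfolding R'_def by (rule Suc.IH) (use Suc.prems s in auto)
    also have "\<dots> \<le> e * t ^ k"
      using s \<open>0 \<le> e\<close> by (intro mult_left_mono power_mono) auto
    finally show "norm (R' s) \<le> e * t ^ k" by simp
  qed (use Suc.prems in auto)
  moreover have "R 0 = 0"
    using gen transition_0[OF p, of F] by (simp add: R_def F_def generates_def sum.atMost_Suc_shift del: sum.atMost_Suc)
  ultimately show ?case
    using Suc.prems unfolding R_def F_def by (simp add: mult_ac)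
qed

lemma transition_Taylor:
  assumes p: "convolution_semigroup p" and f: "f \<in> generator_domain_pow p n" and n: "n \<ge> 1"
  shows "((\<lambda>t. (transition p t f x - (\<Sum>j\<le>n. t ^ j / fact j * (generator p ^^ j) f x)) / t ^ n)
    \<longlongrightarrow> 0) (at_right 0)"
proof (rule tendstoI)
  fix e :: real assume e: "0 < e"
  have u: "(generator p ^^ n) f \<in> C0"
    using generator_domain_pow_generates[OF f, of "n - 1"] n by (auto simp: generates_def)
  obtain d where d: "d > 0" "\<And>h. 0 < h \<Longrightarrow> h < d \<Longrightarrow>
      \<bar>transition p h ((generator p ^^ n) f) x - (generator p ^^ n) f x\<bar> < e / 2"
    using uniform_limitD[OF transition_strongly_continuous[OF p u], of "e/2"] e
    by (auto simp: dist_real_def eventually_at_right_field)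
  have "\<bar>(transition p t f x - (\<Sum>j\<le>n. t ^ j / fact j * (generator p ^^ j) f x)) / t ^ n\<bar> < e"
    if t: "0 < t" "t < d" for t
  proof -
    have "\<bar>transition p t f x - (\<Sum>j\<le>n. t ^ j / fact j * (generator p ^^ j) f x)\<bar> \<le> e / 2 * t ^ n"
    proof -
      have "\<bar>transition p s ((generator p ^^ n) f) x - (generator p ^^ n) f x\<bar> \<le> e / 2"
        if "0 \<le> s" "s \<le> t" for s
        using d(2)[of s] that t e transition_0[OF p u] by (cases "s = 0") auto
      from transition_Taylor_remainder[OF p f this, of t n t] t show ?thesis by simp
    qed
    then have "\<bar>(transition p t f x - (\<Sum>j\<le>n. t ^ j / fact j * (generator p ^^ j) f x)) / t ^ n\<bar> \<le> e / 2"
      using t by (simp add: abs_divide pos_divide_le_eq)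
    then show ?thesis using e by linarith
  qed
  then show "\<forall>\<^sub>F t in at_right 0. dist ((transition p t f x
      - (\<Sum>j\<le>n. t ^ j / fact j * (generator p ^^ j) f x)) / t ^ n) 0 < e"
    unfolding eventually_at_right_field using d(1) by (auto simp: dist_real_def)
qed

section \<open>Gaussian smoothing and superpositions of characters\<close>

definition gauss_density :: "'a::euclidean_space \<Rightarrow> real" where
  "gauss_density x = (\<Prod>b\<in>Basis. std_normal_density (x \<bullet> b))"

text \<open>
  The law of \<open>s Z\<close> for a standard normal vector \<open>Z\<close>. Scaling the variable instead of the density allows
  \<open>s\<close> to be any real number.
\<close>

definition gauss :: "real \<Rightarrow> 'a::euclidean_space measure" where
  "gauss s = distr (density lborel (\<lambda>x. ennreal (gauss_density x))) borel (\<lambda>z. s *\<^sub>R z)"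

lemma gauss_density_measurable [measurable]:
  "gauss_density \<in> borel_measurable (borel :: 'a::euclidean_space measure)"
  unfolding gauss_density_def[abs_def] by measurable

lemma gauss_density_nonneg: "0 \<le> gauss_density x"
  by (simp add: gauss_density_def prod_nonneg)

lemma gauss_density_eq:
  "gauss_density (x :: 'a::euclidean_space) =
     (1 / sqrt (2 * pi)) ^ DIM('a) * exp (- (norm x)\<^sup>2 / 2)"
proof -
  have "(norm x)\<^sup>2 = (\<Sum>b\<in>Basis. (x \<bullet> b)\<^sup>2)"
    unfolding power2_norm_eq_inner by (subst euclidean_inner) (simp add: power2_eq_square)
  then have "exp (- (norm x)\<^sup>2 / 2) = (\<Prod>b\<in>Basis. exp (- (x \<bullet> b)\<^sup>2 / 2))"
    by (simp add: exp_sum[symmetric] sum_negf sum_divide_distrib)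
  then show ?thesis
    by (simp add: gauss_density_def std_normal_density_def prod.distrib prod_dividef power_divide)
qed

lemma sets_gauss [simp, measurable_cong]: "sets (gauss s) = sets borel"
  by (simp add: gauss_def)

lemma gauss_prob: "prob_space (gauss s :: 'a::euclidean_space measure)"
proof -
  have "emeasure (density lborel (\<lambda>x::'a. ennreal (gauss_density x))) UNIV
      = (\<integral>\<^sup>+x. (\<Prod>b\<in>Basis. ennreal (std_normal_density (x \<bullet> b))) \<partial>(lborel :: 'a measure))"
    by (simp add: emeasure_density gauss_density_def prod_ennreal)
  also have "\<dots> = (\<Prod>b\<in>(Basis :: 'a set). (\<integral>\<^sup>+x. ennreal (std_normal_density x) \<partial>lborel))"
    by (rule nn_integral_lborel_prod) auto
  also have "(\<integral>\<^sup>+x. ennreal (std_normal_density x) \<partial>lborel) = 1"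
    using prob_space.emeasure_space_1[OF prob_space_normal_density[of 1 0]]
    by (simp add: emeasure_density)
  finally have "prob_space (density lborel (\<lambda>x::'a. ennreal (gauss_density x)))"
    by (intro prob_spaceI) simp
  then show ?thesis unfolding gauss_def by (intro prob_space.prob_space_distr) auto
qed

lemma gauss_borel_prob: "borel_prob (gauss s)"
  by (simp add: gauss_prob)

lemma integral_gauss:
  fixes f :: "'a::euclidean_space \<Rightarrow> 'b::{banach, second_countable_topology}"
  assumes [measurable]: "f \<in> borel_measurable borel"
  shows "(\<integral>x. f x \<partial>gauss s) = (\<integral>x. gauss_density x *\<^sub>R f (s *\<^sub>R x) \<partial>lborel)"
  unfolding gauss_def
  by (subst integral_distr, simp, simp, subst integral_density) (auto simp: gauss_density_nonneg)

text \<open>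
  The product structure of the density reduces this to the standard normal distribution on the line.
\<close>

lemma gauss_characteristic:
  fixes x :: "'a::euclidean_space"
  shows "(CLINT \<xi>|gauss s. iexp (\<xi> \<bullet> x)) = complex_of_real (exp (- (s * norm x)\<^sup>2 / 2))"
proof -
  interpret product_sigma_finite "\<lambda>_::'a. lborel :: real measure" ..
  define h where "h b u = std_normal_density u *\<^sub>R iexp (s * (x \<bullet> b) * u)" for b :: 'a and u
  have h_int: "(\<integral>u. h b u \<partial>lborel) = complex_of_real (exp (- (s * (x \<bullet> b))\<^sup>2 / 2))" for b
  proof -
    have "(\<integral>u. h b u \<partial>lborel) = char std_normal_distribution (s * (x \<bullet> b))"
      unfolding h_def char_def by (subst integral_density) auto
    then show ?thesis by (simp add: char_std_normal_distribution)
  qed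
  have [measurable]: "h b \<in> borel_measurable borel" for b
    unfolding h_def[abs_def] by measurable
  have h_integrable: "integrable lborel (h b)" for b
  proof (rule Bochner_Integration.integrable_bound[where f = std_normal_density])
    show "integrable lborel std_normal_density"
      using integrable_std_normal_moment[of 0] by simp
  qed (auto simp: h_def norm_mult)
  have "(CLINT \<xi>|gauss s. iexp (\<xi> \<bullet> x)) = (\<integral>\<xi>. gauss_density \<xi> *\<^sub>R iexp ((s *\<^sub>R \<xi>) \<bullet> x) \<partial>lborel)"
    by (rule integral_gauss) simp
  also have "\<dots> = (\<integral>\<xi>. (\<Prod>b\<in>Basis. h b (\<xi> \<bullet> b)) \<partial>lborel)"
  proof (rule Bochner_Integration.integral_cong[OF refl])
    fix \<xi> :: 'a
    have "(s *\<^sub>R \<xi>) \<bullet> x = (\<Sum>b\<in>Basis. s * (x \<bullet> b) * (\<xi> \<bullet> b))"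
      by (subst euclidean_inner) (simp add: mult_ac)
    then have "iexp ((s *\<^sub>R \<xi>) \<bullet> x) = (\<Prod>b\<in>Basis. iexp (s * (x \<bullet> b) * (\<xi> \<bullet> b)))"
      by (simp add: exp_sum[symmetric] sum_distrib_left)
    then show "gauss_density \<xi> *\<^sub>R iexp ((s *\<^sub>R \<xi>) \<bullet> x) = (\<Prod>b\<in>Basis. h b (\<xi> \<bullet> b))"
      by (simp add: gauss_density_def h_def scaleR_conv_of_real prod.distrib)
  qed
  also have "\<dots> = (\<integral>v. (\<Prod>b\<in>Basis. h b (v b)) \<partial>(\<Pi>\<^sub>M b\<in>(Basis :: 'a set). lborel))"
  proof -
    show ?thesis
      by (subst lborel_eq, subst integral_distr) (auto intro!: Bochner_Integration.integral_cong prod.cong)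
  qed
  also have "\<dots> = (\<Prod>b\<in>Basis. complex_of_real (exp (- (s * (x \<bullet> b))\<^sup>2 / 2)))"
    by (subst product_integral_prod) (auto simp: h_integrable h_int)
  also have "\<dots> = complex_of_real (exp (\<Sum>b\<in>Basis. - (s * (x \<bullet> b))\<^sup>2 / 2))"
    by (simp only: of_real_prod exp_sum[OF finite_Basis])
  also have "(\<Sum>b\<in>Basis. - (s * (x \<bullet> b))\<^sup>2 / 2) = - (s * norm x)\<^sup>2 / 2"
  proof -
    have "(s * norm x)\<^sup>2 = s\<^sup>2 * (\<Sum>b\<in>Basis. (x \<bullet> b)\<^sup>2)"
      unfolding power_mult_distrib power2_norm_eq_inner
      by (subst euclidean_inner) (simp add: power2_eq_square)
    then show ?thesis
      by (simp add: power_mult_distrib sum_distrib_left sum_negf sum_divide_distrib)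
  qed
  finally show ?thesis .
qed

text \<open>
  \<open>\<bar>x\<bar> \<le> \<Sum> \<bar>x\<^sub>b\<bar> \<le> \<Prod> (1 + \<bar>x\<^sub>b\<bar>)\<close>, and the integral of the last product against the density factorises.
\<close>

lemma gauss_first_moment:
  shows "integrable (gauss s :: 'a::euclidean_space measure) norm"
proof -
  have "(\<integral>\<^sup>+x. ennreal (gauss_density x * norm x) \<partial>(lborel :: 'a measure))
      \<le> (\<integral>\<^sup>+x. (\<Prod>b\<in>Basis. ennreal (std_normal_density (x \<bullet> b) * (1 + \<bar>x \<bullet> b\<bar>))) \<partial>(lborel :: 'a measure))"
  proof (rule nn_integral_mono)
    fix x :: 'a
    have "norm x \<le> (\<Sum>b\<in>Basis. \<bar>x \<bullet> b\<bar>)" by (rule norm_le_l1)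
    also have "\<dots> \<le> 1 + (\<Sum>b\<in>Basis. \<bar>x \<bullet> b\<bar>)" by simp
    also have "\<dots> \<le> (\<Prod>b\<in>Basis. 1 + \<bar>x \<bullet> b\<bar>)"
    proof -
      have "1 + sum g A \<le> (\<Prod>b\<in>A. 1 + g b) \<and> 0 \<le> sum g A"
        if "finite A" "\<And>b. 0 \<le> g b" for A and g :: "'a \<Rightarrow> real"
        using that(1)
      proof (induction A)
        case (insert a A)
        have "1 + (g a + sum g A) \<le> (1 + g a) * (1 + sum g A)"
          using insert that(2)[of a] by (simp add: algebra_simps)
        also have "\<dots> \<le> (1 + g a) * (\<Prod>b\<in>A. 1 + g b)"
          using insert that(2)[of a] by (intro mult_left_mono) auto
        finally show ?case using insert that(2)[of a] by simp
      qed simp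
      then show ?thesis by simp
    qed
    finally have "norm x \<le> (\<Prod>b\<in>Basis. 1 + \<bar>x \<bullet> b\<bar>)" .
    then have "gauss_density x * norm x \<le> (\<Prod>b\<in>Basis. std_normal_density (x \<bullet> b) * (1 + \<bar>x \<bullet> b\<bar>))"
      unfolding prod.distrib gauss_density_def by (intro mult_left_mono prod_nonneg) auto
    then show "ennreal (gauss_density x * norm x)
      \<le> (\<Prod>b\<in>Basis. ennreal (std_normal_density (x \<bullet> b) * (1 + \<bar>x \<bullet> b\<bar>)))"
      by (subst prod_ennreal) (auto intro: ennreal_leI)
  qed
  also have "\<dots> = (\<Prod>b\<in>(Basis :: 'a set). \<integral>\<^sup>+x. ennreal (std_normal_density x * (1 + \<bar>x\<bar>)) \<partial>lborel)"
    by (rule nn_integral_lborel_prod) auto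
  also have "(\<integral>\<^sup>+x. ennreal (std_normal_density x * (1 + \<bar>x\<bar>)) \<partial>lborel) < \<infinity>"
  proof -
    have "integrable lborel (\<lambda>x. std_normal_density x * (1 + \<bar>x\<bar>))"
      using integrable_std_normal_moment_abs[of 1] integrable_std_normal_moment_abs[of 0]
      by (simp add: algebra_simps)
    from nn_integral_eq_integral[OF this] show ?thesis by simp
  qed
  then have "(\<Prod>b\<in>(Basis :: 'a set). \<integral>\<^sup>+x. ennreal (std_normal_density x * (1 + \<bar>x\<bar>)) \<partial>lborel) < \<infinity>"
    by (simp add: power_less_top_ennreal)
  finally have "integrable lborel (\<lambda>x::'a. gauss_density x * norm x)"
    by (intro integrableI_nonneg) (auto simp: gauss_density_nonneg)
  then have "integrable lborel (\<lambda>x::'a. \<bar>s\<bar> * (gauss_density x * norm x))"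
    by (rule integrable_mult_right)
  then show ?thesis
    unfolding gauss_def
    by (subst integrable_distr_eq, simp, simp, subst integrable_density)
      (auto simp: gauss_density_nonneg mult_ac)
qed

lemma (in pair_sigma_finite) integrable_product_bound:
  fixes f :: "'a \<times> 'b \<Rightarrow> 'c::{banach, second_countable_topology}" and g h :: "_ \<Rightarrow> real"
  assumes [measurable]: "f \<in> borel_measurable (M1 \<Otimes>\<^sub>M M2)"
    and g: "integrable M1 g" and h: "integrable M2 h"
    and bound: "\<And>x y. norm (f (x, y)) \<le> g x * h y"
  shows "integrable (M1 \<Otimes>\<^sub>M M2) f"
proof (rule integrableI_bounded)
  have [measurable]: "g \<in> borel_measurable M1" "h \<in> borel_measurable M2" using g h by auto
  have "(\<integral>\<^sup>+z. ennreal (norm (f z)) \<partial>(M1 \<Otimes>\<^sub>M M2)) = (\<integral>\<^sup>+x. \<integral>\<^sup>+y. ennreal (norm (f (x, y))) \<partial>M2 \<partial>M1)"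
    by (rule M2.nn_integral_fst[symmetric]) simp
  also have "\<dots> \<le> (\<integral>\<^sup>+x. \<integral>\<^sup>+y. ennreal (norm (g x)) * ennreal (norm (h y)) \<partial>M2 \<partial>M1)"
  proof (intro nn_integral_mono)
    fix x y
    have "norm (f (x, y)) \<le> norm (g x) * norm (h y)"
      using bound[of x y] by (metis abs_ge_self abs_mult order_trans real_norm_def)
    then show "ennreal (norm (f (x, y))) \<le> ennreal (norm (g x)) * ennreal (norm (h y))"
      by (simp add: ennreal_mult'[symmetric] ennreal_leI)
  qed
  also have "\<dots> = (\<integral>\<^sup>+x. ennreal (norm (g x)) \<partial>M1) * (\<integral>\<^sup>+y. ennreal (norm (h y)) \<partial>M2)"
    by (simp add: nn_integral_cmult nn_integral_multc)
  also have "\<dots> < \<infinity>"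
    using g h by (simp add: integrable_iff_bounded ennreal_mult_less_top)
  finally show "(\<integral>\<^sup>+z. ennreal (norm (f z)) \<partial>(M1 \<Otimes>\<^sub>M M2)) < \<infinity>" .
qed simp

text \<open>
  \<open>F\<close> is the superposition of the characters \<open>x \<mapsto> exp(i\<langle>\<xi>, x\<rangle>)\<close> with bounded amplitudes \<open>a(\<xi>)\<close> and frequencies
  distributed by \<open>m\<close>. The first moment of \<open>m\<close> makes \<open>F\<close> Lipschitz and \<open>\<psi>\<close> integrable against \<open>m\<close>.
\<close>

definition spectral_form :: "(real ^ 'd) measure \<Rightarrow> (real ^ 'd \<Rightarrow> complex) \<Rightarrow> (real ^ 'd \<Rightarrow> real) \<Rightarrow> bool" where
  "spectral_form m a F \<longleftrightarrow> borel_prob m \<and> integrable m norm \<and> a \<in> borel_measurable borel \<and>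
     bounded (range a) \<and> (\<forall>x. complex_of_real (F x) = (CLINT \<xi>|m. a \<xi> * iexp (\<xi> \<bullet> x)))"

text \<open>
  The Gaussian kernel \<open>exp(- \<bar>w\<bar>\<^sup>2 / (2 s\<^sup>2))\<close> is itself the characteristic function of \<open>gauss (1 / s)\<close>.
  Inserting this into the convolution with \<open>f\<close> and exchanging the integrals exhibits the amplitudes as
  the Fourier transform of \<open>f\<close>, which is bounded because \<open>f\<close> is integrable.
\<close>

lemma gauss_average_spectral:
  fixes f :: "real ^ 'd \<Rightarrow> real"
  assumes f: "integrable lborel f" and s: "s > 0"
  shows "\<exists>a. spectral_form (gauss (1 / s)) a (average (gauss s) f)"
proof -
  define K where "K = (1 / sqrt (2 * pi)) ^ DIM(real ^ 'd) / s ^ DIM(real ^ 'd)"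
  define a where "a \<xi> = of_real K * (CLINT y|lborel. of_real (f y) * iexp (- (\<xi> \<bullet> y)))" for \<xi>
  have [measurable]: "f \<in> borel_measurable borel" using f by auto
  interpret m: prob_space "gauss (1 / s) :: (real ^ 'd) measure" by (rule gauss_prob)
  interpret pair_sigma_finite lborel "gauss (1 / s) :: (real ^ 'd) measure" ..
  have [measurable]: "a \<in> borel_measurable borel"
    unfolding a_def[abs_def] by measurable
  have "norm (a \<xi>) \<le> \<bar>K\<bar> * (\<integral>y. \<bar>f y\<bar> \<partial>lborel)" for \<xi>
  proof -
    have "norm (CLINT y|lborel. of_real (f y) * iexp (- (\<xi> \<bullet> y))) \<le> (\<integral>y. \<bar>f y\<bar> \<partial>lborel)"
      by (rule order_trans[OF integral_norm_bound]) (simp add: norm_mult)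
    then show ?thesis unfolding a_def by (auto simp: norm_mult intro: mult_left_mono)
  qed
  then have "bounded (range a)" by (intro boundedI) auto
  moreover have "complex_of_real (average (gauss s) f x) = (CLINT \<xi>|gauss (1 / s). a \<xi> * iexp (\<xi> \<bullet> x))" for x
  proof -
    have "average (gauss s) f x = (\<integral>z. gauss_density z * f (x + s *\<^sub>R z) \<partial>lborel)"
      unfolding average_def by (subst integral_gauss) auto
    also have "\<dots> = (\<integral>y. gauss_density ((y - x) /\<^sub>R s) * f y \<partial>lborel) / s ^ DIM(real ^ 'd)"
    proof -
      have "(\<integral>y. gauss_density ((y - x) /\<^sub>R s) * f y \<partial>lborel) =
          (\<integral>y. gauss_density ((y - x) /\<^sub>R s) * f y
            \<partial>(density (distr lborel borel (\<lambda>z. x + s *\<^sub>R z)) (\<lambda>_. ennreal (\<bar>s\<bar> ^ DIM(real ^ 'd)))))"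
        using lborel_affine[of s x] s by simp
      also have "\<dots> = s ^ DIM(real ^ 'd) * (\<integral>z. gauss_density z * f (x + s *\<^sub>R z) \<partial>lborel)"
        using s by (subst integral_density) (auto simp: integral_distr)
      finally show ?thesis using s by simp
    qed
    also have "\<dots> = K * (\<integral>y. f y * exp (- (1 / s * norm (x - y))\<^sup>2 / 2) \<partial>lborel)"
    proof -
      have "norm ((y - x) /\<^sub>R s) = 1 / s * norm (x - y)" for y
        using s by (simp add: norm_minus_commute divide_inverse)
      then have "gauss_density ((y - x) /\<^sub>R s) * f y = (K * s ^ DIM(real ^ 'd)) * (f y * exp (- (1 / s * norm (x - y))\<^sup>2 / 2))" for y
        using s by (simp only: gauss_density_eq) (simp add: K_def)
      then show ?thesis using s by (simp only: integral_mult_right_zero) simp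
    qed
    finally have "complex_of_real (average (gauss s) f x) = of_real K *
        (CLINT y|lborel. of_real (f y) * of_real (exp (- (1 / s * norm (x - y))\<^sup>2 / 2)))"
      by (simp only: of_real_mult integral_complex_of_real[symmetric])
    also have "(CLINT y|lborel. of_real (f y) * of_real (exp (- (1 / s * norm (x - y))\<^sup>2 / 2))) =
        (CLINT y|lborel. CLINT \<xi>|gauss (1 / s). of_real (f y) * iexp (\<xi> \<bullet> (x - y)))"
      by (simp only: gauss_characteristic[symmetric] integral_mult_right_zero)
    also have "\<dots> = (CLINT \<xi>|gauss (1 / s). CLINT y|lborel. of_real (f y) * iexp (\<xi> \<bullet> (x - y)))"
      by (rule Fubini_integral[symmetric], rule integrable_product_bound[where g = "\<lambda>y. \<bar>f y\<bar>" and h = "\<lambda>_. 1"])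
        (use f in \<open>auto simp: norm_mult\<close>)
    also have "of_real K * \<dots> = (CLINT \<xi>|gauss (1 / s). a \<xi> * iexp (\<xi> \<bullet> x))"
    proof -
      have "of_real (f y) * iexp (\<xi> \<bullet> (x - y)) = (of_real (f y) * iexp (- (\<xi> \<bullet> y))) * iexp (\<xi> \<bullet> x)" for y \<xi>
        by (simp add: inner_diff_right exp_add[symmetric] algebra_simps)
      then have "(CLINT y|lborel. of_real (f y) * iexp (\<xi> \<bullet> (x - y))) =
          (CLINT y|lborel. of_real (f y) * iexp (- (\<xi> \<bullet> y))) * iexp (\<xi> \<bullet> x)" for \<xi>
        by (simp only: integral_mult_left_zero)
      then show ?thesis
        by (simp only: a_def mult.assoc integral_mult_right_zero)
    qed
    finally show ?thesis .
  qed
  ultimately show ?thesis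
    unfolding spectral_form_def
    by (intro exI[of _ a] conjI allI gauss_borel_prob gauss_first_moment) auto
qed

text \<open>
  The mean of \<open>1 \<and> \<bar>y\<bar>\<close> under \<open>gauss s\<close> is at most \<open>s\<close> times the first moment of \<open>gauss 1\<close>.
\<close>

lemma gauss_average_uniform_limit:
  assumes "f \<in> C0"
  shows "uniform_limit UNIV (\<lambda>k. average (gauss (1 / real (Suc k))) f) f sequentially"
proof (rule average_approximate_identity[OF assms])
  show "\<forall>\<^sub>F k in sequentially. borel_prob (gauss (1 / real (Suc k)))"
    by (simp add: gauss_prob)
  have scale: "(gauss s :: (real ^ 'a) measure) = distr (gauss 1) borel (\<lambda>z. s *\<^sub>R z)" for s
    unfolding gauss_def by (subst distr_distr) (auto simp: o_def)
  interpret prob_space "gauss 1 :: (real ^ 'a) measure" by (rule gauss_prob)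
  have le: "(LINT y|gauss s. min 1 (norm (y :: real ^ 'a))) \<le> s * (LINT y|gauss 1. norm (y :: real ^ 'a))" if "0 \<le> s" for s
  proof -
    have "(LINT y|gauss s. min 1 (norm (y :: real ^ 'a))) = (LINT y|gauss 1. min 1 (norm (s *\<^sub>R (y :: real ^ 'a))))"
      by (subst scale, subst integral_distr) auto
    also have "\<dots> \<le> (LINT y|gauss 1. s * norm (y :: real ^ 'a))"
      using that by (intro integral_mono integrable_mult_right gauss_first_moment integrable_const_bound[of _ 1]) auto
    finally show ?thesis by simp
  qed
  have "(\<lambda>k. (1 / real (Suc k)) * (LINT y|gauss 1. norm (y :: real ^ 'a))) \<longlonglongrightarrow> 0 * (LINT y|gauss 1. norm (y :: real ^ 'a))"
    by (intro tendsto_mult tendsto_const LIMSEQ_Suc[OF lim_1_over_n])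
  then have "(\<lambda>k. (1 / real (Suc k)) * (LINT y|gauss 1. norm (y :: real ^ 'a))) \<longlonglongrightarrow> 0"
    by simp
  then show "(\<lambda>k. LINT y|gauss (1 / real (Suc k)). min 1 (norm (y :: real ^ 'a))) \<longlonglongrightarrow> 0"
    by (rule tendsto_sandwich[OF _ _ tendsto_const, rotated -1])
      (rule always_eventually allI le | simp)+
qed

lemma norm_1_minus_iexp_le: "cmod (1 - iexp (\<xi> \<bullet> z)) \<le> (2 + norm \<xi>) * min 1 (norm z)"
  for \<xi> z :: "'a::real_inner"
proof -
  have "cmod (iexp (\<xi> \<bullet> z) - 1) \<le> \<bar>\<xi> \<bullet> z\<bar>"
    using iexp_approx1[of "\<xi> \<bullet> z" 0] by simp
  also have "\<dots> \<le> norm \<xi> * norm z" by (rule Cauchy_Schwarz_ineq2)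
  finally have 1: "cmod (1 - iexp (\<xi> \<bullet> z)) \<le> norm \<xi> * norm z" by (simp add: norm_minus_commute)
  have 2: "cmod (1 - iexp (\<xi> \<bullet> z)) \<le> 2"
    by (rule order_trans[OF norm_triangle_ineq4]) simp
  show ?thesis
  proof (cases "norm z \<le> 1")
    case True
    then have "min 1 (norm z) = norm z" by simp
    then show ?thesis using 1 by (simp add: distrib_right add_increasing)
  next
    case False
    then have "min 1 (norm z) = 1" by simp
    then have "(2 + norm \<xi>) * min 1 (norm z) = 2 + norm \<xi>" by simp
    then show ?thesis using 2 norm_ge_zero[of \<xi>] by linarith
  qed
qed

lemma average_spectral:
  assumes F: "spectral_form m a F" and \<mu>: "borel_prob \<mu>"
    and char: "\<And>\<xi>. (CLINT x|\<mu>. iexp (\<xi> \<bullet> x)) = c \<xi>"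
  shows "complex_of_real (average \<mu> F x) = (CLINT \<xi>|m. a \<xi> * iexp (\<xi> \<bullet> x) * c \<xi>)"
proof -
  have m: "borel_prob m" and [measurable]: "a \<in> borel_measurable borel" 
    and F_eq: "\<And>x. complex_of_real (F x) = (CLINT \<xi>|m. a \<xi> * iexp (\<xi> \<bullet> x))"
    using F by (auto simp: spectral_form_def)
  obtain B where B: "\<And>\<xi>. cmod (a \<xi>) \<le> B" using F by (auto simp: spectral_form_def bounded_iff)
  interpret m: prob_space m using m by blast
  interpret mu: prob_space \<mu> using \<mu> by blast
  interpret pair_sigma_finite \<mu> m ..
  have [measurable_cong]: "sets m = sets borel" "sets \<mu> = sets borel" using m \<mu> by auto
  have "complex_of_real (average \<mu> F x) = (CLINT y|\<mu>. CLINT \<xi>|m. a \<xi> * iexp (\<xi> \<bullet> (x + y)))"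
    by (simp only: average_def F_eq[symmetric] integral_complex_of_real)
  also have "\<dots> = (CLINT \<xi>|m. CLINT y|\<mu>. a \<xi> * iexp (\<xi> \<bullet> (x + y)))"
    by (rule Fubini_integral[symmetric], rule integrable_product_bound[where g = "\<lambda>_. B" and h = "\<lambda>_. 1"])
      (use B in \<open>auto simp: norm_mult\<close>)
  also have "\<dots> = (CLINT \<xi>|m. a \<xi> * iexp (\<xi> \<bullet> x) * c \<xi>)"
  proof (rule Bochner_Integration.integral_cong[OF refl])
    fix \<xi>
    have "a \<xi> * iexp (\<xi> \<bullet> (x + y)) = a \<xi> * iexp (\<xi> \<bullet> x) * iexp (\<xi> \<bullet> y)" for y
      by (simp add: inner_add_right distrib_left exp_add)
    then show "(CLINT y|\<mu>. a \<xi> * iexp (\<xi> \<bullet> (x + y))) = a \<xi> * iexp (\<xi> \<bullet> x) * c \<xi>"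
      by (simp only: integral_mult_right_zero char)
  qed
  finally show ?thesis .
qed

lemma spectral_modulus:
  assumes F: "spectral_form m a F"
  obtains M where "\<And>x y. \<bar>F (x + y) - F x\<bar> \<le> M * min 1 (norm y)" "0 \<le> M"
proof -
  have m: "borel_prob m" and [measurable]: "a \<in> borel_measurable borel" and mom: "integrable m norm"
    and F_eq: "\<And>x. complex_of_real (F x) = (CLINT \<xi>|m. a \<xi> * iexp (\<xi> \<bullet> x))"
    using F by (auto simp: spectral_form_def)
  obtain B where B: "\<And>\<xi>. cmod (a \<xi>) \<le> B" using F by (auto simp: spectral_form_def bounded_iff)
  then have "0 \<le> B" using norm_ge_zero order_trans by blast
  interpret m: prob_space m using m by blast
  have [measurable_cong]: "sets m = sets borel" using m by auto
  have int: "complex_integrable m (\<lambda>\<xi>. a \<xi> * iexp (\<xi> \<bullet> x))" for x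
    by (rule m.integrable_const_bound[of _ B]) (use B in \<open>auto simp: norm_mult\<close>)
  have "\<bar>F (x + y) - F x\<bar> \<le> (LINT \<xi>|m. B * (2 + norm \<xi>)) * min 1 (norm y)" for x y
  proof -
    have "\<bar>F (x + y) - F x\<bar> = cmod (complex_of_real (F (x + y) - F x))"
      by (simp only: norm_of_real)
    also have "complex_of_real (F (x + y) - F x) = (CLINT \<xi>|m. a \<xi> * iexp (\<xi> \<bullet> (x + y)) - a \<xi> * iexp (\<xi> \<bullet> x))"
      by (subst Bochner_Integration.integral_diff[OF int int]) (simp add: F_eq)
    also have "cmod \<dots> \<le> (LINT \<xi>|m. cmod (a \<xi> * iexp (\<xi> \<bullet> (x + y)) - a \<xi> * iexp (\<xi> \<bullet> x)))"
      by (rule integral_norm_bound)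
    also have "\<dots> \<le> (LINT \<xi>|m. (B * (2 + norm \<xi>)) * min 1 (norm y))"
    proof (rule integral_mono)
      fix \<xi>
      have "a \<xi> * iexp (\<xi> \<bullet> (x + y)) - a \<xi> * iexp (\<xi> \<bullet> x) = - (a \<xi> * iexp (\<xi> \<bullet> x)) * (1 - iexp (\<xi> \<bullet> y))"
        by (simp add: inner_add_right distrib_left exp_add algebra_simps)
      then show "cmod (a \<xi> * iexp (\<xi> \<bullet> (x + y)) - a \<xi> * iexp (\<xi> \<bullet> x)) \<le> (B * (2 + norm \<xi>)) * min 1 (norm y)"
        using mult_mono[OF B[of \<xi>] norm_1_minus_iexp_le[of \<xi> y] \<open>0 \<le> B\<close>]
        by (simp add: norm_mult mult_ac)
    qed (use mom int in auto)
    finally show ?thesis by simp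
  qed
  moreover have "0 \<le> (LINT \<xi>|m. B * (2 + norm \<xi>))" using \<open>0 \<le> B\<close> by (intro integral_nonneg_AE) auto
  ultimately show thesis by (rule that)
qed

text \<open>
  The residue of clipping to \<open>[-e, e]\<close>. For \<open>f \<in> C\<^sub>0\<close> it has bounded support, and since
  \<open>t \<mapsto> t - max (-e) (min e t)\<close> is a contraction, it inherits every modulus of continuity of \<open>f\<close>; a cutoff
  in the space variable would not.
\<close>

definition soft_threshold :: "real \<Rightarrow> (real ^ 'd \<Rightarrow> real) \<Rightarrow> real ^ 'd \<Rightarrow> real" where
  "soft_threshold e f x = f x - max (- e) (min e (f x))"

lemma soft_threshold_props:
  fixes f :: "real ^ 'd \<Rightarrow> real"
  assumes f: "f \<in> C0" and e: "0 < e"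
  shows "soft_threshold e f \<in> C0" "integrable lborel (soft_threshold e f)"
    "\<bar>soft_threshold e f x - f x\<bar> \<le> e"
    "\<bar>soft_threshold e f x - soft_threshold e f y\<bar> \<le> \<bar>f x - f y\<bar>"
proof -
  have "(f \<longlongrightarrow> 0) at_infinity" using f by (auto simp: C0_def)
  from tendstoD[OF this, of e] e obtain R where R: "\<And>x. R \<le> norm x \<Longrightarrow> \<bar>f x\<bar> < e"
    by (auto simp: eventually_at_infinity)
  then have zero: "soft_threshold e f x = 0" if "R \<le> norm x" for x
    using R[OF that] by (auto simp: soft_threshold_def)
  have cont: "continuous_on UNIV (soft_threshold e f)"
    unfolding soft_threshold_def[abs_def] using f by (auto simp: C0_def intro!: continuous_intros)
  have "(soft_threshold e f \<longlongrightarrow> 0) at_infinity"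
    by (rule tendsto_eventually) (auto simp: eventually_at_infinity intro: zero)
  with cont show "soft_threshold e f \<in> C0" by (simp add: C0_def)
  have "integrable lborel (\<lambda>x. indicator (cball 0 R) x *\<^sub>R soft_threshold e f x)"
    by (intro borel_integrable_compact continuous_on_subset[OF cont]) auto
  moreover have "indicator (cball 0 R) x *\<^sub>R soft_threshold e f x = soft_threshold e f x" for x
    using zero[of x] by (cases "norm x \<le> R") auto
  ultimately show "integrable lborel (soft_threshold e f)" by (simp only:)
  show "\<bar>soft_threshold e f x - f x\<bar> \<le> e" using e by (auto simp: soft_threshold_def)
  show "\<bar>soft_threshold e f x - soft_threshold e f y\<bar> \<le> \<bar>f x - f y\<bar>"
    using e by (auto simp: soft_threshold_def max_def min_def abs_if)
qed

lemma soft_threshold_uniform_limit: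
  assumes "f \<in> C0"
  shows "uniform_limit UNIV (\<lambda>k. soft_threshold (1 / real (Suc k)) f) f sequentially"
proof (rule uniform_limitI)
  fix e :: real assume "0 < e"
  then have "\<forall>\<^sub>F k in sequentially. 1 / real (Suc k) < e"
    by (intro order_tendstoD(2)[OF LIMSEQ_Suc[OF lim_1_over_n]])
  then show "\<forall>\<^sub>F k in sequentially. \<forall>x\<in>UNIV. dist (soft_threshold (1 / real (Suc k)) f x) (f x) < e"
  proof eventually_elim
    case (elim k)
    then show ?case
      using soft_threshold_props(3)[OF assms, of "1 / real (Suc k)"]
      by (auto simp only: dist_real_def zero_less_divide_1_iff of_nat_0_less_iff intro: order.strict_trans1)
  qed
qed

text \<open>
  Gaussian smoothing of a soft threshold of \<open>f\<close> is a spectral form, and these are Lipschitz.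
\<close>

lemma C0_bounded_Lipschitz_dense:
  fixes f :: "real ^ 'd \<Rightarrow> real"
  assumes f: "f \<in> C0" and e: "0 < e"
  obtains F M where "F \<in> C0" "\<And>x. \<bar>F x - f x\<bar> < e" "\<And>x y. \<bar>F (x + y) - F x\<bar> \<le> M * min 1 (norm y)"
proof -
  define h where "h = soft_threshold (e / 2) f"
  note h = soft_threshold_props[OF f, of "e / 2", folded h_def]
  have "\<forall>\<^sub>F k in sequentially. \<forall>x. \<bar>average (gauss (1 / real (Suc k))) h x - h x\<bar> < e / 2"
    using uniform_limitD[OF gauss_average_uniform_limit[OF h(1)], of "e/2"] e by (simp add: dist_real_def)
  then obtain k where k: "\<And>x. \<bar>average (gauss (1 / real (Suc k))) h x - h x\<bar> < e / 2"
    by (auto simp: eventually_sequentially)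
  obtain a where "spectral_form (gauss (1 / (1 / real (Suc k)))) a (average (gauss (1 / real (Suc k))) h)"
    using gauss_average_spectral[OF h(2), of "1 / real (Suc k)"] e by auto
  then obtain M where "\<And>x y. \<bar>average (gauss (1 / real (Suc k))) h (x + y) - average (gauss (1 / real (Suc k))) h x\<bar> \<le> M * min 1 (norm y)"
    by (rule spectral_modulus) auto
  moreover have "\<bar>average (gauss (1 / real (Suc k))) h x - f x\<bar> < e" for x
    using k[of x] h(3)[of x] e by linarith
  ultimately show thesis
    using that average_C0[OF gauss_borel_prob h(1)] e by (metis half_gt_zero)
qed

section \<open>The generator as an integral over jumps\<close>

definition jump_integral :: "(real ^ 'd) measure \<Rightarrow> (real ^ 'd \<Rightarrow> real) \<Rightarrow> real ^ 'd \<Rightarrow> real" where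
  "jump_integral \<nu> f x = (LINT y|\<nu>. f (x + y) - f x)"

text \<open>
  By Markov's inequality \<open>\<nu>\<close> is finite on each set \<open>{\<bar>z\<bar> \<ge> 1/n}\<close>; these sets miss only the null set \<open>{0}\<close>.
\<close>

lemma levy_measure_sigma_finite:
  assumes "finite_variation_levy_measure \<nu>"
  shows "sigma_finite_measure \<nu>"
proof
  have [measurable_cong, simp]: "sets \<nu> = sets borel" and int: "integrable \<nu> (\<lambda>z. min 1 (norm z))"
    and zero: "emeasure \<nu> {0} = 0"
    using assms by (auto simp: finite_variation_levy_measure_def)
  have [simp]: "space \<nu> = UNIV" using sets_eq_imp_space_eq[of \<nu> borel] by simp
  define A where "A n = {z \<in> space \<nu>. 1 / real (Suc n) \<le> min 1 (norm z)}" for n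
  have fin: "emeasure \<nu> (A n) \<noteq> \<infinity>" for n
  proof -
    have "emeasure \<nu> (A n) \<le> ennreal (1 / (1 / real (Suc n)) * (LINT z|\<nu>. min 1 (norm z)))"
      unfolding A_def by (rule integral_Markov_inequality[OF int]) auto
    then show ?thesis by (auto simp: top_unique)
  qed
  have "\<exists>n. z \<in> A n" if "z \<noteq> 0" for z
  proof -
    have "0 < norm z" using that by simp
    from reals_Archimedean[OF this] obtain n where n: "inverse (real (Suc n)) < norm z" ..
    have "1 / real (Suc n) \<le> 1" by simp
    then have "z \<in> A n" using n unfolding A_def by (simp add: divide_inverse del: of_nat_Suc)
    then show ?thesis ..
  qed
  then have "\<Union> (insert {0} (range A)) = space \<nu>" by auto
  moreover have "A n \<in> sets \<nu>" for n unfolding A_def by measurable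
  ultimately show "\<exists>A. countable A \<and> A \<subseteq> sets \<nu> \<and> \<Union> A = space \<nu> \<and> (\<forall>a\<in>A. emeasure \<nu> a \<noteq> \<infinity>)"
    using fin zero by (intro exI[of _ "insert {0} (range A)"]) auto
qed

text \<open>
  The derivative of the exponential function is bounded by \<open>1\<close> in the left half-plane.
\<close>

lemma norm_exp_minus_1_le:
  fixes z :: complex
  assumes "Re z \<le> 0"
  shows "cmod (exp z - 1) \<le> cmod z"
proof -
  have "norm (exp z - exp 0) \<le> 1 * norm (z - 0)"
    by (rule field_differentiable_bound[where S = "{z. Re z \<le> 0}" and f' = exp])
      (use assms in \<open>auto intro!: derivative_eq_intros convex_halfspace_Re_le\<close>)
  then show ?thesis by simp
qed

locale levy_jumps =
  fixes \<nu> :: "(real ^ 'd) measure"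
  assumes levy: "finite_variation_levy_measure \<nu>"
begin

lemma sets_levy [simp, measurable_cong]: "sets \<nu> = sets borel"
  using levy by (simp add: finite_variation_levy_measure_def)

lemma levy_integrable: "integrable \<nu> (\<lambda>z. min 1 (norm z))"
  using levy by (simp add: finite_variation_levy_measure_def)

lemma char_exponent_integrable: "complex_integrable \<nu> (\<lambda>z. 1 - iexp (\<xi> \<bullet> z))"
  using integrable_mult_right[OF levy_integrable, of "2 + norm \<xi>"]
  by (rule Bochner_Integration.integrable_bound) (use norm_1_minus_iexp_le[of \<xi>] in \<open>auto intro: order_trans[OF _ abs_ge_self]\<close>)

lemma char_exponent_bound:
  "cmod (char_exponent \<nu> \<xi>) \<le> (2 + norm \<xi>) * (LINT z|\<nu>. min 1 (norm z))"
proof -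
  have "cmod (char_exponent \<nu> \<xi>) \<le> (LINT z|\<nu>. cmod (1 - iexp (\<xi> \<bullet> z)))"
    unfolding char_exponent_def by (rule integral_norm_bound)
  also have "\<dots> \<le> (LINT z|\<nu>. (2 + norm \<xi>) * min 1 (norm z))"
    by (intro integral_mono integrable_norm char_exponent_integrable integrable_mult_right levy_integrable norm_1_minus_iexp_le)
  finally show ?thesis by simp
qed

lemma char_exponent_Re_nonneg: "0 \<le> Re (char_exponent \<nu> \<xi>)"
proof -
  have "Re (char_exponent \<nu> \<xi>) = (LINT z|\<nu>. Re (1 - iexp (\<xi> \<bullet> z)))"
    unfolding char_exponent_def by (rule integral_Re[symmetric]) (rule char_exponent_integrable)
  also have "\<dots> \<ge> 0" by (rule integral_nonneg_AE) (simp add: Re_exp)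
  finally show ?thesis .
qed

lemma char_exponent_measurable [measurable]: "char_exponent \<nu> \<in> borel_measurable borel"
proof -
  interpret sigma_finite_measure \<nu> by (rule levy_measure_sigma_finite[OF levy])
  show ?thesis unfolding char_exponent_def[abs_def] by measurable
qed

lemma jump_integral_spectral:
  assumes F: "spectral_form m a F"
  shows "complex_of_real (jump_integral \<nu> F x) = (CLINT \<xi>|m. a \<xi> * iexp (\<xi> \<bullet> x) * - char_exponent \<nu> \<xi>)"
proof -
  have m: "borel_prob m" and [measurable]: "a \<in> borel_measurable borel" and mom: "integrable m norm"
    and F_eq: "\<And>x. complex_of_real (F x) = (CLINT \<xi>|m. a \<xi> * iexp (\<xi> \<bullet> x))"
    using F by (auto simp: spectral_form_def)
  obtain B where B: "\<And>\<xi>. cmod (a \<xi>) \<le> B" using F by (auto simp: spectral_form_def bounded_iff)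
  then have "0 \<le> B" using norm_ge_zero order_trans by blast
  interpret m: prob_space m using m by blast
  interpret nu: sigma_finite_measure \<nu> by (rule levy_measure_sigma_finite[OF levy])
  interpret pair_sigma_finite \<nu> m ..
  have [measurable_cong]: "sets m = sets borel" using m by auto
  have int: "complex_integrable m (\<lambda>\<xi>. a \<xi> * iexp (\<xi> \<bullet> x))" for x
    by (rule m.integrable_const_bound[of _ B]) (use B in \<open>auto simp: norm_mult\<close>)
  have "complex_of_real (F (x + y) - F x) = (CLINT \<xi>|m. a \<xi> * iexp (\<xi> \<bullet> (x + y)) - a \<xi> * iexp (\<xi> \<bullet> x))" for y
    by (subst Bochner_Integration.integral_diff[OF int int]) (simp add: F_eq)
  then have "complex_of_real (jump_integral \<nu> F x) =
      (CLINT y|\<nu>. CLINT \<xi>|m. a \<xi> * iexp (\<xi> \<bullet> (x + y)) - a \<xi> * iexp (\<xi> \<bullet> x))"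
    by (simp only: jump_integral_def integral_complex_of_real[symmetric])
  also have "\<dots> = (CLINT y|\<nu>. CLINT \<xi>|m. - (a \<xi> * iexp (\<xi> \<bullet> x)) * (1 - iexp (\<xi> \<bullet> y)))"
    by (simp add: inner_add_right distrib_left exp_add algebra_simps)
  also have "\<dots> = (CLINT \<xi>|m. CLINT y|\<nu>. - (a \<xi> * iexp (\<xi> \<bullet> x)) * (1 - iexp (\<xi> \<bullet> y)))"
  proof (rule Fubini_integral[symmetric], rule integrable_product_bound)
    show "integrable \<nu> (\<lambda>z. min 1 (norm z))" by (rule levy_integrable)
    show "integrable m (\<lambda>\<xi>. B * (2 + norm \<xi>))" using mom by simp
    show "norm (case (y, \<xi>) of (y, \<xi>) \<Rightarrow> - (a \<xi> * iexp (\<xi> \<bullet> x)) * (1 - iexp (\<xi> \<bullet> y)))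
        \<le> min 1 (norm y) * (B * (2 + norm \<xi>))" for y \<xi>
      using mult_mono[OF B[of \<xi>] norm_1_minus_iexp_le[of \<xi> y] \<open>0 \<le> B\<close>]
      by (simp add: norm_mult mult_ac)
  qed simp
  also have "\<dots> = (CLINT \<xi>|m. a \<xi> * iexp (\<xi> \<bullet> x) * - char_exponent \<nu> \<xi>)"
    by (simp only: integral_mult_right_zero char_exponent_def) simp
  finally show ?thesis .
qed

text \<open>
  The operators \<open>P\<^sub>t\<close> and \<open>f \<mapsto> \<integral> (f(x + y) - f(x)) \<nu>(dy)\<close> multiply the amplitude at frequency \<open>\<xi>\<close> by
  \<open>exp(-t\<psi>(\<xi>))\<close> and by \<open>-\<psi>(\<xi>)\<close>. The error of the difference quotient is thus at most the mean of
  \<open>\<bar>a\<bar> \<bar>(exp(-t\<psi>) - 1)/t + \<psi>\<bar>\<close>, uniformly in \<open>x\<close>. The integrand tends to \<open>0\<close> and is dominated by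
  \<open>2 \<bar>a\<bar> \<bar>\<psi>\<bar>\<close>, because \<open>Re \<psi> \<ge> 0\<close>.
\<close>

lemma spectral_generates:
  assumes p: "semigroup_with_exponent p (char_exponent \<nu>)"
    and F: "spectral_form m a F" and C0: "F \<in> C0"
  shows "generates p F (jump_integral \<nu> F)"
proof -
  let ?\<psi> = "char_exponent \<nu>"
  have conv: "convolution_semigroup p"
    and char: "\<And>t \<xi>. 0 \<le> t \<Longrightarrow> (CLINT x|p t. iexp (\<xi> \<bullet> x)) = exp (- complex_of_real t * ?\<psi> \<xi>)"
    using p by (auto simp: semigroup_with_exponent_def)
  have m: "borel_prob m" and [measurable]: "a \<in> borel_measurable borel" and mom: "integrable m norm"
    and F_eq: "\<And>x. complex_of_real (F x) = (CLINT \<xi>|m. a \<xi> * iexp (\<xi> \<bullet> x))"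
    using F by (auto simp: spectral_form_def)
  obtain B where B: "\<And>\<xi>. cmod (a \<xi>) \<le> B" using F by (auto simp: spectral_form_def bounded_iff)
  then have "0 \<le> B" using norm_ge_zero order_trans by blast
  interpret m: prob_space m using m by blast
  have [measurable_cong]: "sets m = sets borel" using m by auto
  define D where "D t \<xi> = (exp (- complex_of_real t * ?\<psi> \<xi>) - 1) / of_real t + ?\<psi> \<xi>" for t \<xi>
  have D_meas [measurable]: "D t \<in> borel_measurable borel" for t
    unfolding D_def[abs_def] by measurable
  have D_bound: "cmod (D t \<xi>) \<le> 2 * cmod (?\<psi> \<xi>)" if "0 < t" for t \<xi>
  proof -
    have "cmod (exp (- complex_of_real t * ?\<psi> \<xi>) - 1) \<le> t * cmod (?\<psi> \<xi>)"
      using norm_exp_minus_1_le[of "- complex_of_real t * ?\<psi> \<xi>"] that char_exponent_Re_nonneg[of \<xi>]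
      by (simp add: norm_mult)
    then have "cmod ((exp (- complex_of_real t * ?\<psi> \<xi>) - 1) / of_real t) \<le> cmod (?\<psi> \<xi>)"
      using that by (simp add: norm_divide divide_le_eq mult_ac)
    then show ?thesis unfolding D_def by (intro order_trans[OF norm_triangle_ineq]) simp
  qed
  have psi_int: "integrable m (\<lambda>\<xi>. cmod (?\<psi> \<xi>))"
  proof (rule Bochner_Integration.integrable_bound)
    show "integrable m (\<lambda>\<xi>. (2 + norm \<xi>) * (LINT z|\<nu>. min 1 (norm z)))" using mom by simp
  qed (use char_exponent_bound in \<open>auto intro: order_trans[OF _ abs_ge_self]\<close>)
  have D_int: "complex_integrable m (D t)" if "0 < t" for t
    by (rule Bochner_Integration.integrable_bound[OF integrable_mult_right[OF psi_int, of 2]])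
      (use D_bound[OF that] in auto)
  define R where "R t = (LINT \<xi>|m. B * cmod (D t \<xi>))" for t
  have int: "complex_integrable m (\<lambda>\<xi>. a \<xi> * iexp (\<xi> \<bullet> x) * g \<xi>)"
    if "complex_integrable m g" for g x
    by (rule Bochner_Integration.integrable_bound[OF integrable_mult_right[OF integrable_norm[OF that], of B]])
      (use B that \<open>0 \<le> B\<close> in \<open>auto simp: norm_mult abs_mult intro!: mult_right_mono\<close>)
  have error: "\<bar>(transition p t F x - F x) / t - jump_integral \<nu> F x\<bar> \<le> R t" if t: "0 < t" for t x
  proof -
    have "complex_of_real ((transition p t F x - F x) / t - jump_integral \<nu> F x) =
        (CLINT \<xi>|m. a \<xi> * iexp (\<xi> \<bullet> x) * D t \<xi>)"
    proof -
      have P: "complex_of_real (transition p t F x) =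
          (CLINT \<xi>|m. a \<xi> * iexp (\<xi> \<bullet> x) * exp (- complex_of_real t * ?\<psi> \<xi>))"
        unfolding transition_eq_average
        using t by (intro average_spectral[OF F] convolution_semigroup_prob[OF conv] char) auto
      have i1: "complex_integrable m (\<lambda>\<xi>. exp (- complex_of_real t * ?\<psi> \<xi>))"
        by (rule m.integrable_const_bound[of _ 1])
          (use t char_exponent_Re_nonneg in \<open>auto\<close>)
      have i2: "complex_integrable m (\<lambda>\<xi>. 1)" by simp
      have i3: "complex_integrable m (\<lambda>\<xi>. - ?\<psi> \<xi>)"
        using psi_int by (simp add: integrable_norm_iff)
      have "(CLINT \<xi>|m. a \<xi> * iexp (\<xi> \<bullet> x) * D t \<xi>) =
        (CLINT \<xi>|m. (1 / of_real t) * (a \<xi> * iexp (\<xi> \<bullet> x) * exp (- complex_of_real t * ?\<psi> \<xi>)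
          - a \<xi> * iexp (\<xi> \<bullet> x) * 1) - a \<xi> * iexp (\<xi> \<bullet> x) * - ?\<psi> \<xi>)"
        unfolding D_def by (rule Bochner_Integration.integral_cong[OF refl]) (simp add: algebra_simps diff_divide_distrib)
      also have "\<dots> = (1 / of_real t) * ((CLINT \<xi>|m. a \<xi> * iexp (\<xi> \<bullet> x) * exp (- complex_of_real t * ?\<psi> \<xi>))
          - (CLINT \<xi>|m. a \<xi> * iexp (\<xi> \<bullet> x) * 1)) - (CLINT \<xi>|m. a \<xi> * iexp (\<xi> \<bullet> x) * - ?\<psi> \<xi>)"
        by (simp only: Bochner_Integration.integral_diff integral_mult_right_zero
            Bochner_Integration.integrable_diff integrable_mult_right int[OF i1] int[OF i2] int[OF i3])
      also have "\<dots> = complex_of_real ((transition p t F x - F x) / t - jump_integral \<nu> F x)"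
        by (simp add: P F_eq jump_integral_spectral[OF F])
      finally show ?thesis ..
    qed
    then have "\<bar>(transition p t F x - F x) / t - jump_integral \<nu> F x\<bar> =
        cmod (CLINT \<xi>|m. a \<xi> * iexp (\<xi> \<bullet> x) * D t \<xi>)"
      by (metis norm_of_real)
    also have "\<dots> \<le> (LINT \<xi>|m. cmod (a \<xi> * iexp (\<xi> \<bullet> x) * D t \<xi>))" by (rule integral_norm_bound)
    also have "\<dots> \<le> R t"
      unfolding R_def using D_int[OF t] B
      by (intro integral_mono integrable_norm int integrable_mult_right) (auto simp: norm_mult intro!: mult_right_mono)
    finally show ?thesis .
  qed
  have "(R \<longlongrightarrow> 0) (at_right 0)"
    unfolding tendsto_at_iff_sequentially
  proof (intro allI impI)
    fix T :: "nat \<Rightarrow> real"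
    assume "\<forall>i. T i \<in> {0<..} - {0}" and T0: "T \<longlonglongrightarrow> 0"
    then have T: "0 < T i" for i by auto
    have "(\<lambda>i. LINT \<xi>|m. B * cmod (D (T i) \<xi>)) \<longlonglongrightarrow> (LINT \<xi>|m. 0)"
    proof (rule integral_dominated_convergence[where w = "\<lambda>\<xi>. B * (2 * cmod (?\<psi> \<xi>))"])
      show "integrable m (\<lambda>\<xi>. B * (2 * cmod (?\<psi> \<xi>)))" using psi_int by simp
      show "AE \<xi> in m. norm (B * cmod (D (T i) \<xi>)) \<le> B * (2 * cmod (?\<psi> \<xi>))" for i
        using \<open>0 \<le> B\<close> D_bound[OF T] by (auto simp: abs_mult intro!: mult_left_mono)
      show "AE \<xi> in m. (\<lambda>i. B * cmod (D (T i) \<xi>)) \<longlonglongrightarrow> 0"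
      proof (rule AE_I2)
        fix \<xi>
        have "((\<lambda>z. exp (z * - ?\<psi> \<xi>)) has_field_derivative - ?\<psi> \<xi>) (at 0)"
          by (auto intro!: derivative_eq_intros)
        then have "((\<lambda>z. (exp (z * - ?\<psi> \<xi>) - 1) / z) \<longlongrightarrow> - ?\<psi> \<xi>) (at 0)"
          by (simp add: has_field_derivative_iff)
        moreover have "filterlim (\<lambda>i. complex_of_real (T i)) (at 0) sequentially"
          using T T0 tendsto_of_real[OF T0, where ?'a = complex] by (auto simp: filterlim_at less_le)
        ultimately have "(\<lambda>i. (exp (complex_of_real (T i) * - ?\<psi> \<xi>) - 1) / complex_of_real (T i)) \<longlonglongrightarrow> - ?\<psi> \<xi>"
          by (rule filterlim_compose)
        then have "(\<lambda>i. B * cmod ((exp (complex_of_real (T i) * - ?\<psi> \<xi>) - 1) / complex_of_real (T i) + ?\<psi> \<xi>))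
            \<longlonglongrightarrow> B * cmod (- ?\<psi> \<xi> + ?\<psi> \<xi>)"
          by (intro tendsto_intros)
        then show "(\<lambda>i. B * cmod (D (T i) \<xi>)) \<longlonglongrightarrow> 0"
          by (simp add: D_def)
      qed
    qed auto
    then show "(R \<circ> T) \<longlonglongrightarrow> 0" by (simp add: o_def R_def)
  qed
  then have "uniform_limit UNIV (\<lambda>t x. (transition p t F x - F x) / t) (jump_integral \<nu> F) (at_right 0)"
  proof (intro uniform_limitI)
    fix e :: real assume R0: "(R \<longlongrightarrow> 0) (at_right 0)" and "0 < e"
    then have "\<forall>\<^sub>F t in at_right 0. R t < e" by (auto dest: order_tendstoD)
    then show "\<forall>\<^sub>F t in at_right 0. \<forall>x\<in>UNIV. dist ((transition p t F x - F x) / t) (jump_integral \<nu> F x) < e"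
      using eventually_at_right_less[of 0]
      by eventually_elim (use error in \<open>auto simp: dist_real_def intro: order.strict_trans1\<close>)
  qed
  moreover have "jump_integral \<nu> F \<in> C0"
  proof (rule C0_uniform_limit[OF _ calculation])
    show "\<forall>\<^sub>F t in at_right 0. (\<lambda>x. (transition p t F x - F x) / t) \<in> C0"
      using eventually_at_right_less[of 0]
    proof eventually_elim
      case (elim t)
      then have "(\<lambda>x. (1 / t) * (transition p t F x - F x)) \<in> C0"
        by (intro C0_cmult C0_diff transition_C0[OF conv] C0) auto
      then show ?case by simp
    qed
  qed simp
  ultimately show ?thesis using C0 by (simp add: generates_def)
qed

text \<open>
  The difference of the integrands is at most \<open>min (2w) (2e)\<close>, where \<open>e\<close> bounds \<open>\<bar>f\<^sub>k - g\<bar>\<close>. Its \<open>\<nu>\<close>-integral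
  tends to \<open>0\<close> with \<open>e\<close> by dominated convergence, although \<open>\<nu>\<close> may be infinite.
\<close>

lemma jump_integral_uniform_limit:
  fixes f :: "nat \<Rightarrow> real ^ 'd \<Rightarrow> real"
  assumes w: "integrable \<nu> w"
    and meas: "\<And>k. f k \<in> borel_measurable borel" "g \<in> borel_measurable borel"
    and mod: "\<And>k x y. \<bar>f k (x + y) - f k x\<bar> \<le> w y" "\<And>x y. \<bar>g (x + y) - g x\<bar> \<le> w y"
    and lim: "uniform_limit UNIV f g sequentially"
  shows "uniform_limit UNIV (\<lambda>k. jump_integral \<nu> (f k)) (jump_integral \<nu> g) sequentially"
proof (rule uniform_limitI)
  fix e :: real assume e: "0 < e"
  have [measurable]: "w \<in> borel_measurable borel" using borel_measurable_integrable[OF w] by simp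
  note [measurable] = meas
  have w0: "0 \<le> w y" for y using mod(2)[of 0 y] by linarith
  define b where "b n y = min (2 * w y) (2 / real (Suc n))" for n y
  have [measurable]: "b n \<in> borel_measurable borel" for n unfolding b_def[abs_def] by measurable
  have b_int: "integrable \<nu> (b n)" for n
    by (rule Bochner_Integration.integrable_bound[OF integrable_mult_right[OF w, of 2]])
      (use w0 in \<open>auto simp: b_def\<close>)
  have "(\<lambda>n. LINT y|\<nu>. b n y) \<longlonglongrightarrow> (LINT y|\<nu>. 0)"
  proof (rule integral_dominated_convergence[where w = "\<lambda>y. 2 * w y"])
    have "(\<lambda>n. 2 * (1 / real (Suc n))) \<longlonglongrightarrow> 2 * 0"
      by (intro tendsto_mult tendsto_const LIMSEQ_Suc[OF lim_1_over_n])
    then have "(\<lambda>n. min (2 * w y) (2 / real (Suc n))) \<longlonglongrightarrow> min (2 * w y) 0" for y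
      by (intro tendsto_min tendsto_const) simp
    then show "AE y in \<nu>. (\<lambda>n. b n y) \<longlonglongrightarrow> 0" using w0 by (simp add: b_def min_absorb2)
  qed (use w w0 in \<open>auto simp: b_def[abs_def]\<close>)
  then have "\<forall>\<^sub>F n in sequentially. (LINT y|\<nu>. b n y) < e"
    using e by (intro order_tendstoD(2)[of _ "LINT y|\<nu>. 0"]) auto
  then obtain n where n: "(LINT y|\<nu>. b n y) < e" by (auto simp: eventually_sequentially)
  have "\<forall>\<^sub>F k in sequentially. \<forall>x. \<bar>f k x - g x\<bar> < 1 / real (Suc n)"
    using uniform_limitD[OF lim, of "1 / real (Suc n)"] by (simp add: dist_real_def)
  then show "\<forall>\<^sub>F k in sequentially. \<forall>x\<in>UNIV. dist (jump_integral \<nu> (f k) x) (jump_integral \<nu> g x) < e"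
  proof eventually_elim
    case (elim k)
    show ?case
    proof
      fix x
      have if1: "integrable \<nu> (\<lambda>y. f k (x + y) - f k x)"
        by (rule Bochner_Integration.integrable_bound[OF w]) (use mod w0 in auto)
      have if2: "integrable \<nu> (\<lambda>y. g (x + y) - g x)"
        by (rule Bochner_Integration.integrable_bound[OF w]) (use mod w0 in auto)
      have "\<bar>jump_integral \<nu> (f k) x - jump_integral \<nu> g x\<bar> =
          \<bar>LINT y|\<nu>. (f k (x + y) - f k x) - (g (x + y) - g x)\<bar>"
        by (simp only: jump_integral_def Bochner_Integration.integral_diff[OF if1 if2])
      also have "\<dots> \<le> (LINT y|\<nu>. \<bar>(f k (x + y) - f k x) - (g (x + y) - g x)\<bar>)"
        by (rule integral_abs_bound)
      also have "\<dots> \<le> (LINT y|\<nu>. b n y)"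
      proof (rule integral_mono[OF integrable_abs[OF Bochner_Integration.integrable_diff[OF if1 if2]] b_int])
        fix y
        have "\<bar>(f k (x + y) - f k x) - (g (x + y) - g x)\<bar> \<le> 2 * w y"
          using mod(1)[of k x y] mod(2)[of x y] by linarith
        moreover have "\<bar>(f k (x + y) - f k x) - (g (x + y) - g x)\<bar> \<le> 2 * (1 / real (Suc n))"
          using elim[rule_format, of x] elim[rule_format, of "x + y"] by linarith
        ultimately show "\<bar>(f k (x + y) - f k x) - (g (x + y) - g x)\<bar> \<le> b n y" by (simp add: b_def)
      qed
      finally show "dist (jump_integral \<nu> (f k) x) (jump_integral \<nu> g x) < e"
        using n by (simp add: dist_real_def)
    qed
  qed
qed

lemma generates_integrable_modulus_limit:
  assumes p: "convolution_semigroup p"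
    and gen: "\<And>k::nat. generates p (f k) (jump_integral \<nu> (f k))"
    and g: "g \<in> C0" and w: "integrable \<nu> w"
    and mod: "\<And>k x y. \<bar>f k (x + y) - f k x\<bar> \<le> w y" "\<And>x y. \<bar>g (x + y) - g x\<bar> \<le> w y"
    and lim: "uniform_limit UNIV f g sequentially"
  shows "generates p g (jump_integral \<nu> g)"
proof (rule generates_closed[OF p gen lim])
  show "uniform_limit UNIV (\<lambda>k. jump_integral \<nu> (f k)) (jump_integral \<nu> g) sequentially"
    by (intro jump_integral_uniform_limit[OF w _ _ mod lim] C0_measurable g)
      (use gen in \<open>auto simp: generates_def\<close>)
qed

text \<open>
  Integrable functions in \<open>C\<^sub>0\<close> are limits of their Gaussian smoothings, which are spectral forms;
  arbitrary functions in \<open>C\<^sub>0\<close> are limits of their soft thresholds, which are integrable. The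
  approximations share the modulus \<open>w\<close>.
\<close>

theorem generates_jump_integral:
  assumes p: "semigroup_with_exponent p (char_exponent \<nu>)"
    and f: "f \<in> C0" and w: "integrable \<nu> w" and mod: "\<And>x y. \<bar>f (x + y) - f x\<bar> \<le> w y"
  shows "generates p f (jump_integral \<nu> f)"
proof -
  have conv: "convolution_semigroup p" using p by (simp add: semigroup_with_exponent_def)
  have *: "generates p f (jump_integral \<nu> f)"
    if f: "f \<in> C0" and int: "integrable lborel f" and mod: "\<And>x y. \<bar>f (x + y) - f x\<bar> \<le> w y" for f
  proof (rule generates_integrable_modulus_limit[OF conv _ f w _ mod gauss_average_uniform_limit[OF f]])
    fix k x y
    show "\<bar>average (gauss (1 / real (Suc k))) f (x + y) - average (gauss (1 / real (Suc k))) f x\<bar> \<le> w y"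
      by (rule average_modulus[OF gauss_borel_prob f mod])
    obtain a where "spectral_form (gauss (1 / (1 / real (Suc k)))) a (average (gauss (1 / real (Suc k))) f)"
      using gauss_average_spectral[OF int, of "1 / real (Suc k)"] by auto
    then show "generates p (average (gauss (1 / real (Suc k))) f) (jump_integral \<nu> (average (gauss (1 / real (Suc k))) f))"
      by (rule spectral_generates[OF p _ average_C0[OF gauss_borel_prob f]])
  qed
  note thr = soft_threshold_props[OF f]
  show ?thesis
  proof (rule generates_integrable_modulus_limit[OF conv _ f w _ mod soft_threshold_uniform_limit[OF f]])
    have pos: "0 < 1 / real (Suc k)" for k by simp
    show mod': "\<bar>soft_threshold (1 / real (Suc k)) f (x + y) - soft_threshold (1 / real (Suc k)) f x\<bar> \<le> w y" for k x y
      using thr(4)[OF pos] mod order_trans by blast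
    show "generates p (soft_threshold (1 / real (Suc k)) f) (jump_integral \<nu> (soft_threshold (1 / real (Suc k)) f))" for k
      by (rule *[OF thr(1,2)[OF pos] mod'])
  qed
qed

end

section \<open>The covariance function\<close>

lemma emeasure_lborel_shift:
  fixes B :: "(real ^ 'd) set"
  assumes "B \<in> sets borel"
  shows "emeasure lborel {x. x - y \<in> B} = emeasure lborel B"
proof -
  have "emeasure lborel B = emeasure (distr lborel borel ((+) (- y))) B"
    by (simp add: lborel_distr_plus)
  also have "\<dots> = emeasure lborel {x. x - y \<in> B}"
    using assms by (subst emeasure_distr) (auto simp: vimage_def)
  finally show ?thesis by simp
qed

lemma shift_borel:
  fixes y :: "real ^ 'd"
  assumes [measurable]: "B \<in> sets borel"
  shows "{x. x - y \<in> B} \<in> sets borel"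
proof -
  have "{x. x - y \<in> B} = {x \<in> space borel. x - y \<in> B}" by simp
  also have "\<dots> \<in> sets borel" by measurable
  finally show ?thesis .
qed

lemma image_plus_eq: "(\<lambda>x. x + y) ` \<Omega> = {x. x - y \<in> \<Omega>}"
  for y :: "'a::ab_group_add"
  by (force simp: image_iff algebra_simps)

lemma image_minus_eq: "(\<lambda>z. z - x) ` B = {z. x + z \<in> B}"
  for x :: "'a::ab_group_add"
  by (force simp: image_iff algebra_simps)

lemma measure_shift_eq: "B \<in> sets borel \<Longrightarrow> measure lborel {x. x - y \<in> B} = measure lborel B"
  for B :: "(real ^ 'd) set"
  by (simp add: measure_def emeasure_lborel_shift)

lemma measure_Diff_Int:
  assumes "A \<in> fmeasurable M" "B \<in> sets M"
  shows "measure M (A - B) = measure M A - measure M (A \<inter> B)"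
proof -
  have "measure M (A - A \<inter> B) = measure M A - measure M (A \<inter> B)"
    using assms by (intro measure_Diff) (auto simp: fmeasurable_def)
  then show ?thesis by (simp add: Diff_Int)
qed

locale finite_open_set =
  fixes \<Omega> :: "(real ^ 'd) set"
  assumes op: "open \<Omega>" and fin: "emeasure lborel \<Omega> < \<infinity>"
begin

lemma Omega_borel [measurable]: "\<Omega> \<in> sets borel"
  using op by simp

lemma shift_Omega_borel [measurable]: "{x. x - y \<in> \<Omega>} \<in> sets borel"
  by (rule shift_borel) simp

lemma shift_fmeasurable: "{x. x - y \<in> \<Omega>} \<in> fmeasurable lborel"
  using fin by (intro fmeasurableI) (auto simp: emeasure_lborel_shift)

lemma Omega_fmeasurable: "\<Omega> \<in> fmeasurable lborel"
  using fin by (intro fmeasurableI) auto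

lemma covariance_eq: "covariance \<Omega> y = measure lborel (\<Omega> \<inter> {x. x - y \<in> \<Omega>})"
  by (simp add: covariance_def image_plus_eq)

lemma covariance_0: "covariance \<Omega> 0 = measure lborel \<Omega>"
  by (simp add: covariance_eq)

lemma covariance_nonneg: "0 \<le> covariance \<Omega> y"
  by (simp add: covariance_def)

lemma covariance_loss: "covariance \<Omega> 0 - covariance \<Omega> y = measure lborel (\<Omega> - {x. x - y \<in> \<Omega>})"
  by (simp add: covariance_0 covariance_eq measure_Diff_Int[OF Omega_fmeasurable])

lemma covariance_loss': "covariance \<Omega> 0 - covariance \<Omega> y = measure lborel ({x. x - y \<in> \<Omega>} - \<Omega>)"
  by (simp add: covariance_0 covariance_eq measure_Diff_Int[OF shift_fmeasurable] measure_shift_eq Int_commute)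

lemma covariance_le: "covariance \<Omega> y \<le> covariance \<Omega> 0"
  using covariance_loss[of y] measure_nonneg[of lborel "\<Omega> - {x. x - y \<in> \<Omega>}"] by linarith

lemma covariance_even: "covariance \<Omega> (- y) = covariance \<Omega> y"
proof -
  have "{x. x - y \<in> \<Omega> \<inter> {x. x - (- y) \<in> \<Omega>}} = \<Omega> \<inter> {x. x - y \<in> \<Omega>}" by auto
  then show ?thesis
    unfolding covariance_eq using measure_shift_eq[of "\<Omega> \<inter> {x. x - (- y) \<in> \<Omega>}" y]
      Omega_borel shift_Omega_borel[of "- y"] by (metis sets.Int)
qed

text \<open>
  Both bounds come from \<open>|\<Omega> \<inter> (\<Omega> + y + h)| - |\<Omega> \<inter> (\<Omega> + y)| \<le> |(\<Omega> + y + h) - (\<Omega> + y)|\<close> and its mirror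
  image, whose right-hand sides are translates of \<open>(\<Omega> + h) - \<Omega>\<close> and \<open>\<Omega> - (\<Omega> + h)\<close>.
\<close>

lemma covariance_modulus:
  "\<bar>covariance \<Omega> (y + h) - covariance \<Omega> y\<bar> \<le> covariance \<Omega> 0 - covariance \<Omega> h"
proof -
  let ?A = "\<lambda>y. {x. x - y \<in> \<Omega>}"
  have le: "measure lborel (\<Omega> \<inter> A) \<le> measure lborel (\<Omega> \<inter> B) + measure lborel (A - B)"
    if "A \<in> fmeasurable lborel" "B \<in> fmeasurable lborel" for A B
  proof -
    have [simp]: "A \<in> sets borel" "B \<in> sets borel" using that by (auto dest: fmeasurableD)
    have "measure lborel (\<Omega> \<inter> A) \<le> measure lborel ((\<Omega> \<inter> B) \<union> (A - B))"
      using that Omega_fmeasurable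
      by (intro measure_mono_fmeasurable fmeasurable.Un fmeasurable.Int fmeasurable.Diff) auto
    also have "\<dots> \<le> measure lborel (\<Omega> \<inter> B) + measure lborel (A - B)"
      using that by (intro measure_Un_le) auto
    finally show ?thesis .
  qed
  have "?A (y + h) - ?A y = {x. x - y \<in> ?A h - \<Omega>}" "?A y - ?A (y + h) = {x. x - y \<in> \<Omega> - ?A h}"
    by (auto simp: algebra_simps)
  then have "measure lborel (?A (y + h) - ?A y) = covariance \<Omega> 0 - covariance \<Omega> h"
    "measure lborel (?A y - ?A (y + h)) = covariance \<Omega> 0 - covariance \<Omega> h"
    using measure_shift_eq[of "?A h - \<Omega>" y] measure_shift_eq[of "\<Omega> - ?A h" y]
    by (simp_all add: covariance_loss[of h, symmetric] covariance_loss'[of h, symmetric])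
  then show ?thesis
    using le[OF shift_fmeasurable[of "y + h"] shift_fmeasurable[of y]]
      le[OF shift_fmeasurable[of y] shift_fmeasurable[of "y + h"]]
    unfolding covariance_eq[symmetric] by linarith
qed

text \<open>
  The product of the indicators of \<open>\<Omega>\<close> at \<open>x\<close> and \<open>x - h\<close> converges for every \<open>x\<close> as \<open>h \<rightarrow> 0\<close>: if
  \<open>x \<in> \<Omega>\<close>, then \<open>x - h \<in> \<Omega>\<close> for small \<open>h\<close>, because \<open>\<Omega>\<close> is open.
\<close>

lemma covariance_continuous_0: "isCont (covariance \<Omega>) 0"
proof (rule continuous_at_sequentiallyI)
  fix h :: "nat \<Rightarrow> real ^ 'd" assume h: "h \<longlonglongrightarrow> 0"
  have eq: "covariance \<Omega> y = (\<integral>x. indicat_real \<Omega> x * indicator \<Omega> (x - y) \<partial>lborel)" for y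
  proof -
    have "(\<integral>x. indicat_real \<Omega> x * indicator \<Omega> (x - y) \<partial>lborel) =
      (\<integral>x. indicat_real (\<Omega> \<inter> {x. x - y \<in> \<Omega>}) x \<partial>lborel)"
      by (rule Bochner_Integration.integral_cong) (auto simp: indicator_def)
    then show ?thesis by (simp add: covariance_eq)
  qed
  have "(\<lambda>n. \<integral>x. indicat_real \<Omega> x * indicator \<Omega> (x - h n) \<partial>lborel) \<longlonglongrightarrow> (\<integral>x. indicator \<Omega> x * indicator \<Omega> (x - 0) \<partial>lborel)"
  proof (rule integral_dominated_convergence[where w = "indicator \<Omega>"])
    show "integrable lborel (indicator \<Omega> :: _ \<Rightarrow> real)" using fin by simp
    show "AE x in lborel. (\<lambda>n. indicator \<Omega> x * indicator \<Omega> (x - h n)) \<longlonglongrightarrow> (indicator \<Omega> x * indicator \<Omega> (x - 0) :: real)"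
    proof (rule AE_I2)
      fix x
      show "(\<lambda>n. indicator \<Omega> x * indicator \<Omega> (x - h n)) \<longlonglongrightarrow> (indicator \<Omega> x * indicator \<Omega> (x - 0) :: real)"
      proof (cases "x \<in> \<Omega>")
        case True
        have "(\<lambda>n. x - h n) \<longlonglongrightarrow> x - 0" by (intro tendsto_intros h)
        then have "\<forall>\<^sub>F n in sequentially. x - h n \<in> \<Omega>"
          using op True by (intro topological_tendstoD) auto
        then show ?thesis by (intro tendsto_eventually) (auto elim!: eventually_mono simp: True)
      qed simp
    qed
  qed (auto simp: indicator_def)
  then show "(\<lambda>n. covariance \<Omega> (h n)) \<longlonglongrightarrow> covariance \<Omega> 0" by (simp add: eq)
qed

text \<open>
  The modulus \<open>g(0) - g(h)\<close> spreads continuity from the origin to all points. If \<open>\<bar>y\<bar> \<ge> 2R\<close>, a point of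
  \<open>\<Omega> \<inter> (\<Omega> + y)\<close> is outside the ball of radius \<open>R\<close> itself or after translation by \<open>-y\<close>, so the decay at
  infinity follows from \<open>\<bar>\<Omega> - ball 0 R\<bar> \<rightarrow> 0\<close>.
\<close>

lemma covariance_C0: "covariance \<Omega> \<in> C0"
proof -
  have "isCont (covariance \<Omega>) y" for y
  proof -
    have "((\<lambda>h. covariance \<Omega> 0 - covariance \<Omega> h) \<longlongrightarrow> covariance \<Omega> 0 - covariance \<Omega> 0) (at 0)"
      using covariance_continuous_0 by (intro tendsto_diff tendsto_const) (simp add: isCont_def)
    then have lim: "((\<lambda>h. covariance \<Omega> 0 - covariance \<Omega> h) \<longlongrightarrow> 0) (at 0)" by simp
    have "((\<lambda>h. covariance \<Omega> (y + h) - covariance \<Omega> y) \<longlongrightarrow> 0) (at 0)"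
      by (rule Lim_null_comparison[OF _ lim]) (simp add: covariance_modulus)
    then have "((\<lambda>h. covariance \<Omega> (y + h)) \<longlongrightarrow> covariance \<Omega> y) (at 0)"
      by (simp add: LIM_zero_iff)
    then show ?thesis by (simp add: isCont_iff)
  qed
  then have cont: "continuous_on UNIV (covariance \<Omega>)" by (simp add: continuous_on_eq_continuous_at)
  have "(covariance \<Omega> \<longlongrightarrow> 0) at_infinity"
  proof (rule tendstoI)
    fix e :: real assume e: "0 < e"
    define T where "T n = \<Omega> - ball 0 (real n)" for n :: nat
    have T: "T n \<in> fmeasurable lborel" for n
      unfolding T_def by (intro fmeasurable_Diff[OF Omega_fmeasurable]) auto
    have "(\<lambda>n. measure lborel (T n)) \<longlonglongrightarrow> measure lborel (\<Inter>n. T n)"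
      using T by (intro Lim_measure_decseq) (auto simp: T_def decseq_def fmeasurable_def less_top)
    moreover have "(\<Inter>n. T n) = {}"
    proof -
      have "y \<notin> (\<Inter>n. T n)" for y
      proof -
        obtain m :: nat where "norm y < real m" using reals_Archimedean2 by blast
        then have "y \<notin> T m" by (simp add: T_def)
        then show ?thesis by blast
      qed
      then show ?thesis by blast
    qed
    ultimately have "(\<lambda>n. measure lborel (T n)) \<longlonglongrightarrow> 0" by simp
    then have "\<forall>\<^sub>F n in sequentially. measure lborel (T n) < e / 2"
      using e by (intro order_tendstoD(2)) auto
    then obtain n where n: "measure lborel (T n) < e / 2" by (auto simp: eventually_sequentially)
    have "dist (covariance \<Omega> y) 0 < e" if y: "2 * real n \<le> norm y" for y
    proof -
      have Ts: "{x. x - y \<in> T n} \<in> sets borel"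
        using T[of n] by (intro shift_borel) (auto simp: fmeasurable_def)
      have "\<Omega> \<inter> {x. x - y \<in> \<Omega>} \<subseteq> T n \<union> {x. x - y \<in> T n}"
      proof
        fix x assume x: "x \<in> \<Omega> \<inter> {x. x - y \<in> \<Omega>}"
        have "norm y \<le> norm x + norm (x - y)" by norm
        then have "real n \<le> norm x \<or> real n \<le> norm (x - y)" using y by linarith
        then show "x \<in> T n \<union> {x. x - y \<in> T n}" using x by (auto simp: T_def)
      qed
      then have "covariance \<Omega> y \<le> measure lborel (T n \<union> {x. x - y \<in> T n})"
        unfolding covariance_eq using T[of n] Ts
        by (intro measure_mono_fmeasurable fmeasurable.Un fmeasurableI)
          (auto simp: emeasure_lborel_shift fmeasurable_def)
      also have "\<dots> \<le> measure lborel (T n) + measure lborel {x. x - y \<in> T n}"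
        using T[of n] Ts by (intro measure_Un_le) (auto simp: fmeasurable_def)
      also have "\<dots> < e" using n T[of n] by (simp add: measure_shift_eq fmeasurable_def)
      finally show ?thesis using covariance_nonneg[of y] by simp
    qed
    then show "\<forall>\<^sub>F y in at_infinity. dist (covariance \<Omega> y) 0 < e"
      by (auto simp: eventually_at_infinity intro!: exI[of _ "2 * real n"])
  qed
  with cont show ?thesis by (simp add: C0_def)
qed

section \<open>Heat loss and perimeter in terms of the covariance function\<close>

text \<open>
  For a measure \<open>\<mu>\<close> of jumps, the mass that jumps from \<open>\<Omega>\<close> out of \<open>\<Omega>\<close>, with the order of
  integration exchanged: a jump \<open>y\<close> leads out of \<open>\<Omega>\<close> from a set of measure \<open>g(0) - g(-y)\<close>, and \<open>g\<close>
  is even. The heat loss is the case \<open>\<mu> = p\<^sub>t\<close>, the perimeter the case \<open>\<mu> = \<nu>\<close>.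
\<close>

lemma nn_integral_exit:
  assumes \<mu>: "sigma_finite_measure \<mu>" and sets: "sets \<mu> = sets borel"
  shows "(\<integral>\<^sup>+x\<in>\<Omega>. emeasure \<mu> ((\<lambda>z. z - x) ` (- \<Omega>)) \<partial>lborel)
      = (\<integral>\<^sup>+y. ennreal (covariance \<Omega> 0 - covariance \<Omega> y) \<partial>\<mu>)" (is ?eq)
    and "(\<lambda>x. emeasure \<mu> ((\<lambda>z. z - x) ` (- \<Omega>))) \<in> borel_measurable borel" (is ?meas)
proof -
  interpret mu: sigma_finite_measure \<mu> by (rule \<mu>)
  interpret pair_sigma_finite lborel \<mu> ..
  note [measurable_cong, simp] = sets
  have [simp]: "space \<mu> = UNIV" using sets_eq_imp_space_eq[OF sets] by simp
  have [measurable]: "- \<Omega> \<in> sets borel" using op by auto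
  have exit: "emeasure \<mu> ((\<lambda>z. z - x) ` (- \<Omega>)) = (\<integral>\<^sup>+y. indicator (- \<Omega>) (x + y) \<partial>\<mu>)" for x
  proof -
    have "{z. x + z \<in> - \<Omega>} = {z \<in> space borel. x + z \<in> - \<Omega>}" by simp
    also have "\<dots> \<in> sets borel" by measurable
    finally have "emeasure \<mu> {z. x + z \<in> - \<Omega>} = (\<integral>\<^sup>+y. indicator {z. x + z \<in> - \<Omega>} y \<partial>\<mu>)"
      by simp
    then show ?thesis by (simp add: image_minus_eq indicator_def)
  qed
  have pair: "sets (M \<Otimes>\<^sub>M \<mu>) = sets (borel \<Otimes>\<^sub>M borel)" if "sets M = sets borel" for M :: "(real ^ 'd) measure"
    using that by (intro sets_pair_measure_cong) auto
  have "(\<lambda>(x, y). indicator (- \<Omega>) (x + y) :: ennreal) \<in> borel_measurable (borel \<Otimes>\<^sub>M borel)"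
    by measurable
  then have "(\<lambda>(x, y). indicator (- \<Omega>) (x + y) :: ennreal) \<in> borel_measurable (borel \<Otimes>\<^sub>M \<mu>)"
    by (simp add: pair cong: measurable_cong_sets)
  then show ?meas unfolding exit by (rule mu.borel_measurable_nn_integral)
  have "(\<lambda>y. indicator (- \<Omega>) (x + y) :: ennreal) \<in> borel_measurable borel" for x
    by measurable
  then have slice: "(\<lambda>y. indicator (- \<Omega>) (x + y) :: ennreal) \<in> borel_measurable \<mu>" for x
    by (simp cong: measurable_cong_sets)
  have "(\<lambda>(x, y). indicator (- \<Omega>) (x + y) * indicator \<Omega> x :: ennreal) \<in> borel_measurable (borel \<Otimes>\<^sub>M borel)"
    by measurable
  then have joint: "(\<lambda>(x, y). indicator (- \<Omega>) (x + y) * indicator \<Omega> x :: ennreal) \<in> borel_measurable (lborel \<Otimes>\<^sub>M \<mu>)"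
    by (simp add: pair cong: measurable_cong_sets)
  have "(\<integral>\<^sup>+x\<in>\<Omega>. emeasure \<mu> ((\<lambda>z. z - x) ` (- \<Omega>)) \<partial>lborel) =
      (\<integral>\<^sup>+x. \<integral>\<^sup>+y. indicator (- \<Omega>) (x + y) * indicator \<Omega> x \<partial>\<mu> \<partial>lborel)"
    unfolding exit by (subst nn_integral_multc[OF slice]) auto
  also have "\<dots> = (\<integral>\<^sup>+y. \<integral>\<^sup>+x. indicator (- \<Omega>) (x + y) * indicator \<Omega> x \<partial>lborel \<partial>\<mu>)"
    by (rule Fubini'[symmetric, OF joint])
  also have "\<dots> = (\<integral>\<^sup>+y. ennreal (covariance \<Omega> 0 - covariance \<Omega> y) \<partial>\<mu>)"
  proof (rule nn_integral_cong)
    fix y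
    have "(\<integral>\<^sup>+x. indicator (- \<Omega>) (x + y) * indicator \<Omega> x \<partial>lborel) =
      (\<integral>\<^sup>+x. indicator (\<Omega> - {x. x - (- y) \<in> \<Omega>}) x \<partial>lborel)"
      by (rule nn_integral_cong) (auto simp: indicator_def)
    also have "\<dots> = emeasure lborel (\<Omega> - {x. x - (- y) \<in> \<Omega>})"
      using shift_Omega_borel[of "- y"] by (intro nn_integral_indicator) auto
    also have "\<dots> = ennreal (measure lborel (\<Omega> - {x. x - (- y) \<in> \<Omega>}))"
      using fmeasurable.Diff[OF Omega_fmeasurable shift_fmeasurable[of "- y"]]
      by (intro emeasure_eq_measure2) auto
    finally show "(\<integral>\<^sup>+x. indicator (- \<Omega>) (x + y) * indicator \<Omega> x \<partial>lborel)
        = ennreal (covariance \<Omega> 0 - covariance \<Omega> y)"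
      unfolding covariance_loss[symmetric] covariance_even .
  qed
  finally show ?eq .
qed

lemma nonlocal_perimeter_eq:
  assumes "finite_variation_levy_measure \<nu>"
  shows "nonlocal_perimeter \<nu> \<Omega> = (\<integral>\<^sup>+y. ennreal (covariance \<Omega> 0 - covariance \<Omega> y) \<partial>\<nu>)"
  unfolding nonlocal_perimeter_def
  by (rule nn_integral_exit(1)) (use assms levy_measure_sigma_finite in \<open>auto simp: finite_variation_levy_measure_def\<close>)

lemma heat_loss_eq:
  assumes p: "convolution_semigroup p" and t: "0 \<le> t"
  shows "heat_loss p \<Omega> t = covariance \<Omega> 0 - transition p t (covariance \<Omega>) 0"
proof -
  have pt: "borel_prob (p t)" by (rule convolution_semigroup_prob[OF p t])
  interpret prob_space "p t" using pt by blast
  note exit = nn_integral_exit[of "p t", OF sigma_finite_measure_axioms]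
  have [measurable]: "(\<lambda>x. emeasure (p t) ((\<lambda>z. z - x) ` (- \<Omega>))) \<in> borel_measurable borel"
    using exit pt by blast
  have [measurable]: "(\<lambda>x. measure (p t) ((\<lambda>z. z - x) ` (- \<Omega>))) \<in> borel_measurable borel"
    unfolding measure_def by measurable
  have int: "integrable (p t) (\<lambda>y. covariance \<Omega> 0 - covariance \<Omega> y)"
    using C0_shift_integrable[OF pt covariance_C0, of 0] by simp
  have "heat_loss p \<Omega> t = enn2real (\<integral>\<^sup>+x. ennreal (indicator \<Omega> x * measure (p t) ((\<lambda>z. z - x) ` (- \<Omega>))) \<partial>lborel)"
    unfolding heat_loss_def set_lebesgue_integral_def
    by (subst integral_eq_nn_integral) auto
  also have "(\<integral>\<^sup>+x. ennreal (indicator \<Omega> x * measure (p t) ((\<lambda>z. z - x) ` (- \<Omega>))) \<partial>lborel) =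
      (\<integral>\<^sup>+x\<in>\<Omega>. emeasure (p t) ((\<lambda>z. z - x) ` (- \<Omega>)) \<partial>lborel)"
    by (rule nn_integral_cong) (auto simp: indicator_def emeasure_eq_measure)
  also have "\<dots> = ennreal (\<integral>y. covariance \<Omega> 0 - covariance \<Omega> y \<partial>p t)"
    using exit(1) pt int covariance_le by (subst nn_integral_eq_integral[symmetric]) auto
  also have "enn2real \<dots> = (\<integral>y. covariance \<Omega> 0 - covariance \<Omega> y \<partial>p t)"
    using covariance_le by (intro enn2real_ennreal integral_nonneg_AE) auto
  also have "\<dots> = covariance \<Omega> 0 - transition p t (covariance \<Omega>) 0"
    using C0_shift_integrable[OF pt covariance_C0, of 0]
    by (subst Bochner_Integration.integral_diff) (auto simp: transition_def prob_space)
  finally show ?thesis .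
qed

end

section \<open>Finiteness of the perimeter\<close>

text \<open>
  Choose Lipschitz \<open>F\<close> with \<open>\<bar>F - f\<bar> < e\<close> and put \<open>k = min F (f(0) - e)\<close>. The cap makes \<open>k\<close> maximal at the
  origin, with \<open>0 \<le> k(0) - k(y) \<le> f(0) - f(y)\<close>. Integrating against \<open>p\<^sub>t / t\<close> and letting \<open>t \<rightarrow> 0\<close> gives
  \<open>\<integral> (k(0) - k(y)) \<nu>(dy) \<le> - u(0)\<close>, since the generator is an integral over jumps on Lipschitz functions.
  Fatou's lemma for \<open>e \<rightarrow> 0\<close> transfers the bound to \<open>f\<close>.
\<close>

lemma integrable_drop_from_maximum:
  fixes f :: "real ^ 'd \<Rightarrow> real"
  assumes levy: "finite_variation_levy_measure \<nu>"
    and p: "semigroup_with_exponent p (char_exponent \<nu>)"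
    and gen: "generates p f u" and le: "\<And>y. f y \<le> f 0" and pos: "0 < f 0"
  shows "integrable \<nu> (\<lambda>y. f 0 - f y)"
proof -
  interpret levy_jumps \<nu> by unfold_locales (rule levy)
  have conv: "convolution_semigroup p" using p by (simp add: semigroup_with_exponent_def)
  have f: "f \<in> C0" using gen by (simp add: generates_def)
  have [measurable]: "f \<in> borel_measurable borel" by (rule C0_measurable[OF f])
  \<comment> \<open>multiples of \<open>f 0\<close>, to keep the cap \<open>f 0 - e n\<close> nonnegative, so that \<open>k n\<close> still tends to \<open>0\<close> at infinity\<close>
  define e where "e n = f 0 / real (Suc n)" for n
  have e: "0 < e n" "e n \<le> f 0" for n 
  proof -
    show "0 < e n" using pos by (simp add: e_def)
    have "f 0 / real (Suc n) \<le> f 0 / 1" by (rule divide_left_mono) (use pos in auto)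
    then show "e n \<le> f 0" by (simp add: e_def)
  qed
  have "\<exists>F. F \<in> C0 \<and> (\<forall>x. \<bar>F x - f x\<bar> < e n) \<and> (\<exists>M. \<forall>x y. \<bar>F (x + y) - F x\<bar> \<le> M * min 1 (norm y))" for n
  proof -
    obtain F M where "F \<in> C0" "\<And>x. \<bar>F x - f x\<bar> < e n" "\<And>x y. \<bar>F (x + y) - F x\<bar> \<le> M * min 1 (norm y)"
      by (rule C0_bounded_Lipschitz_dense[OF f e(1)[of n]]) (rule that)
    then show ?thesis by (intro exI[of _ F] conjI allI exI[of _ M])
  qed
  then obtain F where F': "\<And>n. F n \<in> C0 \<and> (\<forall>x. \<bar>F n x - f x\<bar> < e n) \<and>
      (\<exists>M. \<forall>x y. \<bar>F n (x + y) - F n x\<bar> \<le> M * min 1 (norm y))"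
    by metis
  then have F: "F n \<in> C0" "\<bar>F n x - f x\<bar> < e n" for n x by auto
  obtain M where M: "\<And>n x y. \<bar>F n (x + y) - F n x\<bar> \<le> M n * min 1 (norm y)"
    using F' by metis
  define k where "k n y = min (F n y) (f 0 - e n)" for n y
  have k0: "k n 0 = f 0 - e n" for n using F(2)[of n 0] by (auto simp: k_def)
  have k_drop: "0 \<le> k n 0 - k n y" "k n 0 - k n y \<le> f 0 - f y" for n y
    using F(2)[of n y] le[of y] unfolding k0 by (auto simp: k_def)
  have kC: "k n \<in> C0" for n
  proof -
    have "((\<lambda>y. min (F n y) (f 0 - e n)) \<longlongrightarrow> min 0 (f 0 - e n)) at_infinity"
      using F(1)[of n] by (intro tendsto_intros) (auto simp: C0_def)
    then show ?thesis
      using F(1)[of n] e(2)[of n] by (auto simp: C0_def k_def[abs_def] intro!: continuous_intros)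
  qed
  have [measurable]: "k n \<in> borel_measurable borel" for n by (rule C0_measurable[OF kC])
  have k_mod: "\<bar>k n (x + y) - k n x\<bar> \<le> M n * min 1 (norm y)" for n x y
    using M[of n x y] by (auto simp: k_def)
  have M_int: "integrable \<nu> (\<lambda>y. M n * min 1 (norm y))" for n
    using levy_integrable by simp
  have k_int: "integrable \<nu> (\<lambda>y. k n 0 - k n y)" for n
    by (rule Bochner_Integration.integrable_bound[OF M_int[of n]])
      (use k_mod[of n 0] in \<open>auto simp: abs_minus_commute intro: order_trans[OF _ abs_ge_self]\<close>)
  have bound: "(LINT y|\<nu>. k n 0 - k n y) \<le> - u 0" for n
  proof -
    have "generates p (k n) (jump_integral \<nu> (k n))"
      by (rule generates_jump_integral[OF p kC M_int k_mod])
    then have 1: "((\<lambda>t. (transition p t (k n) 0 - k n 0) / t) \<longlongrightarrow> jump_integral \<nu> (k n) 0) (at_right 0)"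
      by (auto simp: generates_def intro: tendsto_uniform_limitI)
    have 2: "((\<lambda>t. (transition p t f 0 - f 0) / t) \<longlongrightarrow> u 0) (at_right 0)"
      using gen by (auto simp: generates_def intro: tendsto_uniform_limitI)
    have "\<forall>\<^sub>F t in at_right 0. (transition p t f 0 - f 0) / t \<le> (transition p t (k n) 0 - k n 0) / t"
      using eventually_at_right_less[of 0]
    proof eventually_elim
      case (elim t)
      have pt: "borel_prob (p t)" using convolution_semigroup_prob[OF conv] elim by auto
      interpret prob_space "p t" using pt by blast
      have "(\<integral>y. k n 0 - k n y \<partial>p t) \<le> (\<integral>y. f 0 - f y \<partial>p t)"
        using C0_shift_integrable[OF pt kC[of n], of 0] C0_shift_integrable[OF pt f, of 0] k_drop
        by (intro integral_mono) auto
      then have "k n 0 - transition p t (k n) 0 \<le> f 0 - transition p t f 0"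
        using C0_shift_integrable[OF pt kC[of n], of 0] C0_shift_integrable[OF pt f, of 0]
        by (simp add: transition_def prob_space)
      then show ?case using elim by (intro divide_right_mono) auto
    qed
    then have "u 0 \<le> jump_integral \<nu> (k n) 0" by (intro tendsto_le[OF _ 1 2]) auto
    also have "\<dots> = (LINT y|\<nu>. - (k n 0 - k n y))" by (simp add: jump_integral_def)
    also have "\<dots> = - (LINT y|\<nu>. k n 0 - k n y)" by (rule Bochner_Integration.integral_minus)
    finally show ?thesis by simp
  qed
  have e_lim: "e \<longlonglongrightarrow> 0"
  proof -
    have "(\<lambda>n. f 0 * (1 / real (Suc n))) \<longlonglongrightarrow> f 0 * 0"
      by (intro tendsto_mult tendsto_const LIMSEQ_Suc[OF lim_1_over_n])
    then show ?thesis by (simp add: e_def[abs_def])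
  qed
  have lim: "(\<lambda>n. k n 0 - k n y) \<longlonglongrightarrow> f 0 - f y" for y
  proof -
    have "(\<lambda>n. F n y - f y) \<longlonglongrightarrow> 0"
      by (rule Lim_null_comparison[OF _ e_lim]) (use F(2) in \<open>auto intro!: always_eventually less_imp_le\<close>)
    then have "(\<lambda>n. F n y) \<longlonglongrightarrow> f y" by (simp add: LIM_zero_iff)
    then have "(\<lambda>n. (f 0 - e n) - min (F n y) (f 0 - e n)) \<longlonglongrightarrow> (f 0 - 0) - min (f y) (f 0 - 0)"
      by (intro tendsto_intros e_lim)
    then show ?thesis using le[of y] unfolding k0 by (simp add: k_def)
  qed
  have "(\<integral>\<^sup>+y. ennreal (f 0 - f y) \<partial>\<nu>) = (\<integral>\<^sup>+y. liminf (\<lambda>n. ennreal (k n 0 - k n y)) \<partial>\<nu>)"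
    using lim by (intro nn_integral_cong lim_imp_Liminf[symmetric] tendsto_ennrealI) auto
  also have "\<dots> \<le> liminf (\<lambda>n. \<integral>\<^sup>+y. ennreal (k n 0 - k n y) \<partial>\<nu>)"
    by (rule nn_integral_liminf) measurable
  also have "\<dots> = liminf (\<lambda>n. ennreal (LINT y|\<nu>. k n 0 - k n y))"
    using k_int k_drop by (simp add: nn_integral_eq_integral)
  also have "\<dots> \<le> liminf (\<lambda>n. ennreal (- u 0))"
    by (intro Liminf_mono always_eventually allI ennreal_leI bound)
  also have "\<dots> < \<infinity>" by (simp add: Liminf_const)
  finally show ?thesis
    using le by (intro integrableI_nonneg) auto
qed

section \<open>Loss of smoothness under the generator\<close>

definition holder :: "real \<Rightarrow> (real ^ 'd \<Rightarrow> real) \<Rightarrow> bool" where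
  "holder \<beta> f \<longleftrightarrow> (\<exists>M. \<forall>x y. \<bar>f x - f y\<bar> \<le> M * norm (x - y) powr \<beta>)"

locale stable_like_jumps = levy_jumps +
  fixes \<alpha> C :: real
  assumes \<alpha>: "0 < \<alpha>" and C: "C > 0"
    and scaling: "\<And>\<kappa> r. 0 < \<kappa> \<Longrightarrow> \<kappa> \<le> 1 \<Longrightarrow> 0 < r \<Longrightarrow> r < 1 \<Longrightarrow>
           concentration \<nu> (\<kappa> * r) \<le> C * \<kappa> powr (- \<alpha>) * concentration \<nu> r"
begin

lemma concentration_integrable:
  assumes r: "0 < r"
  shows "integrable \<nu> (\<lambda>x. min 1 ((norm x)\<^sup>2 / r\<^sup>2))"
proof (rule Bochner_Integration.integrable_bound[OF integrable_mult_right[OF levy_integrable, of "max 1 (1 / r\<^sup>2)"]])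
  have "min 1 ((norm x)\<^sup>2 / r\<^sup>2) \<le> max 1 (1 / r\<^sup>2) * min 1 (norm x)" for x :: "real ^ 'a"
  proof (cases "norm x \<le> 1")
    case True
    then have "(norm x)\<^sup>2 \<le> norm x" by (simp add: power2_eq_square mult_left_le)
    then have "(norm x)\<^sup>2 / r\<^sup>2 \<le> 1 / r\<^sup>2 * norm x" using r by (simp add: divide_right_mono)
    also have "\<dots> \<le> max 1 (1 / r\<^sup>2) * norm x" by (intro mult_right_mono) auto
    finally show ?thesis using True by simp
  qed simp
  then show "AE x in \<nu>. norm (min 1 ((norm x)\<^sup>2 / r\<^sup>2)) \<le> norm (max 1 (1 / r\<^sup>2) * min 1 (norm x))"
    by (auto intro!: order_trans[OF _ abs_ge_self])
qed simp

lemma tail_le_concentration: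
  assumes r: "0 < r"
  shows "emeasure \<nu> {z. r \<le> norm z} \<le> ennreal (concentration \<nu> r)"
proof -
  have [simp]: "space \<nu> = UNIV" using sets_eq_imp_space_eq[OF sets_levy] by simp
  have "{z. r \<le> norm z} = {z \<in> space \<nu>. 1 \<le> min 1 ((norm z)\<^sup>2 / r\<^sup>2)}"
    using r by (auto simp: le_divide_eq power_mono_iff)
  also have "emeasure \<nu> \<dots> \<le> ennreal (1 / 1 * (LINT x|\<nu>. min 1 ((norm x)\<^sup>2 / r\<^sup>2)))"
    by (rule integral_Markov_inequality[OF concentration_integrable[OF r]]) auto
  finally show ?thesis by (simp add: concentration_def)
qed

lemma concentration_nonneg: "0 \<le> concentration \<nu> r"
  unfolding concentration_def by (rule integral_nonneg_AE) auto

text \<open>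
  Compare \<open>r\<close> with the reference radius \<open>1/2\<close>: the scaling hypothesis at \<open>\<kappa> = 2r\<close> covers \<open>r \<le> 1/2\<close>, and
  monotonicity of the tail covers the rest.
\<close>

lemma tail_bound:
  obtains K where "0 \<le> K" "\<And>r. 0 < r \<Longrightarrow> r \<le> 1 \<Longrightarrow> emeasure \<nu> {z. r \<le> norm z} \<le> ennreal (K * r powr - \<alpha>)"
proof
  define K where "K = (C + 1) * concentration \<nu> (1/2)"
  show "0 \<le> (C + 1) * concentration \<nu> (1/2)" using C concentration_nonneg by simp
  fix r :: real assume r: "0 < r" "r \<le> 1"
  have c: "0 \<le> concentration \<nu> (1/2)" by (rule concentration_nonneg)
  show "emeasure \<nu> {z. r \<le> norm z} \<le> ennreal ((C + 1) * concentration \<nu> (1/2) * r powr - \<alpha>)"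
  proof (cases "r \<le> 1/2")
    case True
    have "concentration \<nu> r \<le> C * (2 * r) powr (- \<alpha>) * concentration \<nu> (1/2)"
      using scaling[of "2 * r" "1/2"] r True by simp
    also have "(2 * r) powr - \<alpha> \<le> r powr - \<alpha>" using r \<alpha> by (intro powr_mono2') auto
    then have "C * (2 * r) powr (- \<alpha>) * concentration \<nu> (1/2) \<le> C * r powr (- \<alpha>) * concentration \<nu> (1/2)"
      using C c by (intro mult_right_mono mult_left_mono) auto
    also have "\<dots> \<le> (C + 1) * concentration \<nu> (1/2) * r powr - \<alpha>"
      using c by (simp add: algebra_simps)
    finally show ?thesis by (intro order_trans[OF tail_le_concentration[OF r(1)]] ennreal_leI)
  next
    case False
    have "emeasure \<nu> {z. r \<le> norm z} \<le> emeasure \<nu> {z. 1/2 \<le> norm z}"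
      using False by (intro emeasure_mono) auto
    also have "\<dots> \<le> ennreal (concentration \<nu> (1/2))" by (rule tail_le_concentration) simp
    also have "\<dots> \<le> ennreal ((C + 1) * concentration \<nu> (1/2) * r powr - \<alpha>)"
    proof (rule ennreal_leI)
      have "1 powr - \<alpha> \<le> r powr - \<alpha>" using r \<alpha> by (intro powr_mono2') auto
      then have "1 \<le> (C + 1) * r powr - \<alpha>"
        using C mult_mono[of 1 "C + 1" 1 "r powr - \<alpha>"] by simp
      then show "concentration \<nu> (1/2) \<le> (C + 1) * concentration \<nu> (1/2) * r powr - \<alpha>"
        using mult_right_mono[OF _ c, of 1 "(C + 1) * r powr - \<alpha>"] by (simp add: mult_ac)
    qed
    finally show ?thesis .
  qed
qed

text \<open>
  Dyadic decomposition with \<open>x\<^sub>j = 2\<^sup>-\<^sup>j \<rho>\<close>: the integrand is at most \<open>\<Sum>\<^sub>j (2x\<^sub>j)\<^sup>\<beta> 1(\<bar>z\<bar> \<ge> x\<^sub>j)\<close>, and by the tail bound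
  the terms integrate to at most a constant times \<open>\<rho>\<^sup>\<beta>\<^sup>-\<^sup>\<alpha> q\<^sup>j\<close> with \<open>q = 2\<^sup>\<alpha>\<^sup>-\<^sup>\<beta> < 1\<close>.
\<close>

lemma truncated_power_integral:
  assumes \<beta>: "\<alpha> < \<beta>"
  obtains K where "0 \<le> K" "\<And>\<rho>. 0 < \<rho> \<Longrightarrow> \<rho> \<le> 1 \<Longrightarrow>
    (\<integral>\<^sup>+z. ennreal (min (norm z powr \<beta>) (\<rho> powr \<beta>)) \<partial>\<nu>) \<le> ennreal (K * \<rho> powr (\<beta> - \<alpha>))"
proof -
  obtain K where K: "0 \<le> K" "\<And>r. 0 < r \<Longrightarrow> r \<le> 1 \<Longrightarrow> emeasure \<nu> {z. r \<le> norm z} \<le> ennreal (K * r powr - \<alpha>)"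
    by (rule tail_bound) blast
  define q where "q = (1/2 :: real) powr (\<beta> - \<alpha>)"
  have q: "0 < q" "q < 1" using \<beta> by (auto simp: q_def powr01_less_one)
  have main: "(\<integral>\<^sup>+z. ennreal (min (norm z powr \<beta>) (\<rho> powr \<beta>)) \<partial>\<nu>)
      \<le> ennreal (K * 2 powr \<beta> * (1 / (1 - q)) * \<rho> powr (\<beta> - \<alpha>))" if \<rho>: "0 < \<rho>" "\<rho> \<le> 1" for \<rho>
  proof -
    define x where "x j = (1/2) ^ j * \<rho>" for j :: nat
    have x: "0 < x j" "x j \<le> 1" for j
    proof -
      show "0 < x j" using \<rho> by (simp add: x_def)
      have "(1/2 :: real) ^ j * \<rho> \<le> 1 * 1" using \<rho> by (intro mult_mono power_le_one) auto
      then show "x j \<le> 1" by (simp add: x_def)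
    qed
    have summand: "(2 * x j) powr \<beta> * (K * x j powr - \<alpha>) = K * 2 powr \<beta> * \<rho> powr (\<beta> - \<alpha>) * q ^ j" for j
    proof -
      have "(2 * x j) powr \<beta> * (K * x j powr - \<alpha>) = K * 2 powr \<beta> * (x j powr \<beta> * x j powr - \<alpha>)"
        using x[of j] by (simp add: powr_mult)
      also have "x j powr \<beta> * x j powr - \<alpha> = x j powr (\<beta> - \<alpha>)" by (simp add: powr_add[symmetric])
      also have "\<dots> = ((1/2) ^ j) powr (\<beta> - \<alpha>) * \<rho> powr (\<beta> - \<alpha>)" using \<rho> by (simp add: x_def powr_mult)
      also have "((1/2 :: real) ^ j) powr (\<beta> - \<alpha>) = q ^ j"
        unfolding q_def by (simp add: powr_realpow[symmetric] powr_powr mult.commute)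
      finally show ?thesis by (simp only: mult_ac)
    qed
    have "(\<integral>\<^sup>+z. ennreal (min (norm z powr \<beta>) (\<rho> powr \<beta>)) \<partial>\<nu>)
        \<le> (\<integral>\<^sup>+z. (\<Sum>j. ennreal ((2 * x j) powr \<beta>) * indicator {z. x j \<le> norm z} z) \<partial>\<nu>)"
    proof (rule nn_integral_mono)
      fix z :: "real ^ 'a"
      show "ennreal (min (norm z powr \<beta>) (\<rho> powr \<beta>))
          \<le> (\<Sum>j. ennreal ((2 * x j) powr \<beta>) * indicator {z. x j \<le> norm z} z)"
      proof (cases "z = 0")
        case False
        have "(\<lambda>j. (1/2) ^ j * \<rho>) \<longlonglongrightarrow> 0 * \<rho>" by (intro tendsto_intros LIMSEQ_power_zero) simp
        then have "\<forall>\<^sub>F j in sequentially. x j < norm z"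
          unfolding x_def[abs_def] using False by (intro order_tendstoD(2)) auto
        then have ex: "\<exists>j. x j \<le> norm z" by (auto simp: eventually_sequentially intro: less_imp_le)
        \<comment> \<open>the least such \<open>j\<close> gives \<open>norm z < 2 * x j\<close>, or \<open>j = 0\<close> and then \<open>\<rho> \<le> 2 * x j\<close>\<close>
        define j where "j = (LEAST j. x j \<le> norm z)"
        have j: "x j \<le> norm z" unfolding j_def by (rule LeastI_ex[OF ex])
        have "min (norm z) \<rho> \<le> 2 * x j"
        proof (cases j)
          case 0
          then show ?thesis using \<rho> by (simp add: x_def)
        next
          case (Suc i)
          then have "\<not> x i \<le> norm z" unfolding j_def by (metis lessI not_less_Least)
          then show ?thesis by (simp add: Suc x_def)
        qed
        then have "min (norm z) \<rho> powr \<beta> \<le> (2 * x j) powr \<beta>"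
          using \<rho> \<alpha> \<beta> by (intro powr_mono2) auto
        moreover have "min (norm z powr \<beta>) (\<rho> powr \<beta>) \<le> min (norm z) \<rho> powr \<beta>" by (simp add: min_def)
        moreover define h :: "nat \<Rightarrow> ennreal" where "h i = ennreal ((2 * x i) powr \<beta>) * indicator {z. x i \<le> norm z} z" for i
        ultimately have "ennreal (min (norm z powr \<beta>) (\<rho> powr \<beta>)) \<le> h j"
          using j by (simp add: h_def ennreal_leI)
        also have "h j = sum h {j}" by simp
        also have "\<dots> \<le> suminf h" by (rule sum_le_suminf) auto
        finally show ?thesis by (simp only: h_def[abs_def])
      qed simp
    qed
    also have "\<dots> = (\<Sum>j. \<integral>\<^sup>+z. ennreal ((2 * x j) powr \<beta>) * indicator {z. x j \<le> norm z} z \<partial>\<nu>)"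
      by (rule nn_integral_suminf) measurable
    also have "\<dots> \<le> (\<Sum>j. ennreal (K * 2 powr \<beta> * \<rho> powr (\<beta> - \<alpha>) * q ^ j))"
    proof (rule suminf_le)
      fix j
      have "(\<integral>\<^sup>+z. ennreal ((2 * x j) powr \<beta>) * indicator {z. x j \<le> norm z} z \<partial>\<nu>)
          = ennreal ((2 * x j) powr \<beta>) * emeasure \<nu> {z. x j \<le> norm z}"
        by (rule nn_integral_cmult_indicator) simp
      also have "\<dots> \<le> ennreal ((2 * x j) powr \<beta>) * ennreal (K * x j powr - \<alpha>)"
        by (intro mult_left_mono K(2) x) simp
      also have "\<dots> = ennreal (K * 2 powr \<beta> * \<rho> powr (\<beta> - \<alpha>) * q ^ j)"
        by (simp only: ennreal_mult'[symmetric] powr_ge_zero summand)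
      finally show "(\<integral>\<^sup>+z. ennreal ((2 * x j) powr \<beta>) * indicator {z. x j \<le> norm z} z \<partial>\<nu>)
          \<le> ennreal (K * 2 powr \<beta> * \<rho> powr (\<beta> - \<alpha>) * q ^ j)" .
    qed auto
    also have "\<dots> = ennreal (\<Sum>j. K * 2 powr \<beta> * \<rho> powr (\<beta> - \<alpha>) * q ^ j)"
      using q K(1) by (intro suminf_ennreal2 summable_mult summable_geometric) auto
    also have "(\<Sum>j. K * 2 powr \<beta> * \<rho> powr (\<beta> - \<alpha>) * q ^ j) = K * 2 powr \<beta> * (1 / (1 - q)) * \<rho> powr (\<beta> - \<alpha>)"
      using q by (subst suminf_mult) (auto simp: suminf_geometric intro!: summable_geometric)
    finally show ?thesis .
  qed
  show thesis
    by (rule that[OF _ main]) (use K(1) q in auto)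
qed

lemma truncated_power_integrable:
  assumes "\<alpha> < \<beta>" "0 < \<rho>" "\<rho> \<le> 1"
  shows "integrable \<nu> (\<lambda>z. min (norm z powr \<beta>) (\<rho> powr \<beta>))"
proof -
  obtain K where "(\<integral>\<^sup>+z. ennreal (min (norm z powr \<beta>) (\<rho> powr \<beta>)) \<partial>\<nu>) \<le> ennreal (K * \<rho> powr (\<beta> - \<alpha>))"
    using truncated_power_integral[OF assms(1)] assms(2,3) by metis
  then show ?thesis
    by (intro integrableI_nonneg) (auto intro: order.strict_trans1)
qed

text \<open>
  Let \<open>\<rho> = \<bar>x - y\<bar>\<close>. The increments of \<open>f\<close> along a jump \<open>z\<close> from \<open>x\<close> and from \<open>y\<close> differ by at most
  \<open>2M min (\<bar>z\<bar>\<^sup>\<beta>) (\<rho>\<^sup>\<beta>)\<close>: compare each increment with \<open>0\<close>, or the end points with each other. The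
  \<open>\<nu>\<close>-integral of this is of order \<open>\<rho>\<^sup>\<beta>\<^sup>-\<^sup>\<alpha>\<close>.
\<close>

lemma holder_generator:
  assumes p: "semigroup_with_exponent p (char_exponent \<nu>)"
    and f: "f \<in> C0" "holder \<beta> f" and \<beta>: "\<alpha> < \<beta>"
  shows "f \<in> generator_domain p" "generator p f \<in> C0" "holder (\<beta> - \<alpha>) (generator p f)"
proof -
  obtain M0 where M0: "\<And>x y. \<bar>f x - f y\<bar> \<le> M0 * norm (x - y) powr \<beta>"
    using f(2) by (auto simp: holder_def)
  define M where "M = max M0 0"
  have M: "0 \<le> M" "\<bar>f x - f y\<bar> \<le> M * norm (x - y) powr \<beta>" for x y
  proof -
    have "M0 * norm (x - y) powr \<beta> \<le> M * norm (x - y) powr \<beta>"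
      by (intro mult_right_mono) (auto simp: M_def)
    then show "\<bar>f x - f y\<bar> \<le> M * norm (x - y) powr \<beta>" using M0[of x y] by linarith
  qed (simp add: M_def)
  obtain B where B: "\<And>x. \<bar>f x\<bar> \<le> B" "0 \<le> B" using f(1) by (rule C0_bounded) auto
  define w where "w z = max M (2 * B) * min (norm z powr \<beta>) (1 powr \<beta>)" for z :: "real ^ 'a"
  have w_int: "integrable \<nu> w"
    unfolding w_def[abs_def] using truncated_power_integrable[OF \<beta>, of 1] by simp
  have w: "\<bar>f (x + z) - f x\<bar> \<le> w z" for x z
  proof (cases "norm z powr \<beta> \<le> 1")
    case True
    have "\<bar>f (x + z) - f x\<bar> \<le> M * norm z powr \<beta>" using M(2)[of "x + z" x] by simp
    also have "\<dots> \<le> max M (2 * B) * norm z powr \<beta>" by (intro mult_right_mono) auto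
    finally show ?thesis using True by (simp add: w_def)
  next
    case False
    then show ?thesis using B(1)[of "x + z"] B(1)[of x] by (auto simp: w_def)
  qed
  have gen: "generates p f (jump_integral \<nu> f)"
    by (rule generates_jump_integral[OF p f(1) w_int w])
  then have eq: "generator p f = jump_integral \<nu> f" by (rule generates_generator)
  show "f \<in> generator_domain p" using gen eq by (simp add: generator_domain_generates)
  show LC: "generator p f \<in> C0" using gen eq by (simp add: generates_def)
  obtain B' where B': "\<And>x. \<bar>generator p f x\<bar> \<le> B'" "0 \<le> B'" using LC by (rule C0_bounded) auto
  obtain K where K: "0 \<le> K" "\<And>\<rho>. 0 < \<rho> \<Longrightarrow> \<rho> \<le> 1 \<Longrightarrow>
    (\<integral>\<^sup>+z. ennreal (min (norm z powr \<beta>) (\<rho> powr \<beta>)) \<partial>\<nu>) \<le> ennreal (K * \<rho> powr (\<beta> - \<alpha>))"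
    by (rule truncated_power_integral[OF \<beta>]) blast
  have [measurable]: "f \<in> borel_measurable borel" by (rule C0_measurable[OF f(1)])
  have "\<bar>generator p f x - generator p f y\<bar> \<le> max (2 * M * K) (2 * B') * norm (x - y) powr (\<beta> - \<alpha>)" for x y
  proof -
    define \<rho> where "\<rho> = norm (x - y)"
    consider "\<rho> = 0" | "0 < \<rho>" "\<rho> \<le> 1" | "1 < \<rho>" by (auto simp: \<rho>_def) linarith
    then have "\<bar>generator p f x - generator p f y\<bar> \<le> max (2 * M * K) (2 * B') * \<rho> powr (\<beta> - \<alpha>)"
    proof cases
      case 1
      then show ?thesis by (simp add: \<rho>_def)
    next
      case 2
      have int: "integrable \<nu> (\<lambda>z. f (x + z) - f x)" for x
        by (rule Bochner_Integration.integrable_bound[OF w_int]) (use w in \<open>auto intro: order_trans[OF _ abs_ge_self]\<close>)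
      have mint: "integrable \<nu> (\<lambda>z. 2 * M * min (norm z powr \<beta>) (\<rho> powr \<beta>))"
        using truncated_power_integrable[OF \<beta> 2] by simp
      have "\<bar>generator p f x - generator p f y\<bar> = \<bar>LINT z|\<nu>. (f (x + z) - f x) - (f (y + z) - f y)\<bar>"
        unfolding eq jump_integral_def by (simp only: Bochner_Integration.integral_diff[OF int int])
      also have "\<dots> \<le> (LINT z|\<nu>. \<bar>(f (x + z) - f x) - (f (y + z) - f y)\<bar>)" by (rule integral_abs_bound)
      also have "\<dots> \<le> (LINT z|\<nu>. 2 * M * min (norm z powr \<beta>) (\<rho> powr \<beta>))"
      proof (rule integral_mono[OF integrable_abs[OF Bochner_Integration.integrable_diff[OF int int]] mint])
        fix z
        have "\<bar>(f (x + z) - f x) - (f (y + z) - f y)\<bar> \<le> 2 * (M * norm z powr \<beta>)"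
          using M(2)[of "x + z" x] M(2)[of "y + z" y] by simp
        moreover have "\<bar>(f (x + z) - f x) - (f (y + z) - f y)\<bar> \<le> 2 * (M * \<rho> powr \<beta>)"
          using M(2)[of "x + z" "y + z"] M(2)[of x y] by (simp add: \<rho>_def)
        ultimately show "\<bar>(f (x + z) - f x) - (f (y + z) - f y)\<bar> \<le> 2 * M * min (norm z powr \<beta>) (\<rho> powr \<beta>)"
          by (simp add: min_def)
      qed
      also have "\<dots> = 2 * M * (LINT z|\<nu>. min (norm z powr \<beta>) (\<rho> powr \<beta>))" by simp
      also have "\<dots> \<le> 2 * M * (K * \<rho> powr (\<beta> - \<alpha>))"
      proof -
        have "ennreal (LINT z|\<nu>. min (norm z powr \<beta>) (\<rho> powr \<beta>)) \<le> ennreal (K * \<rho> powr (\<beta> - \<alpha>))"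
          using K(2)[OF 2] by (subst (asm) nn_integral_eq_integral[OF truncated_power_integrable[OF \<beta> 2]]) auto
        then have "(LINT z|\<nu>. min (norm z powr \<beta>) (\<rho> powr \<beta>)) \<le> K * \<rho> powr (\<beta> - \<alpha>)"
          using K(1) by (subst (asm) ennreal_le_iff) auto
        then show ?thesis using M(1) by (intro mult_left_mono) auto
      qed
      also have "\<dots> \<le> max (2 * M * K) (2 * B') * \<rho> powr (\<beta> - \<alpha>)"
        unfolding mult.assoc[symmetric] by (intro mult_right_mono) auto
      finally show ?thesis .
    next
      case 3
      have "\<bar>generator p f x - generator p f y\<bar> \<le> 2 * B'" using B'(1)[of x] B'(1)[of y] by linarith
      also have "\<dots> \<le> max (2 * M * K) (2 * B') * 1" by simp
      also have "\<dots> \<le> max (2 * M * K) (2 * B') * \<rho> powr (\<beta> - \<alpha>)"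
        using 3 \<beta> B'(2) by (intro mult_left_mono ge_one_powr_ge_zero) auto
      finally show ?thesis .
    qed
    then show ?thesis by (simp only: \<rho>_def)
  qed
  then show "holder (\<beta> - \<alpha>) (generator p f)" by (auto simp: holder_def)
qed

lemma Lipschitz_generator_domain_pow:
  assumes p: "semigroup_with_exponent p (char_exponent \<nu>)"
    and f: "f \<in> C0" "holder 1 f" and n: "real n * \<alpha> < 1"
  shows "f \<in> generator_domain_pow p n"
proof -
  have *: "(generator p ^^ k) f \<in> C0 \<and> holder (1 - real k * \<alpha>) ((generator p ^^ k) f)" if "k \<le> n" for k
    using that
  proof (induction k)
    case (Suc k)
    have "real (Suc k) * \<alpha> \<le> real n * \<alpha>" using Suc.prems \<alpha> by (intro mult_right_mono) auto
    then have "\<alpha> < 1 - real k * \<alpha>" using n by (simp add: algebra_simps)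
    from holder_generator[OF p _ _ this] Suc show ?case by (simp add: algebra_simps)
  qed (use f in simp)
  have "(generator p ^^ k) f \<in> generator_domain p" if "k < n" for k
  proof -
    have "real (Suc k) * \<alpha> \<le> real n * \<alpha>" using that \<alpha> by (intro mult_right_mono) auto
    then have "\<alpha> < 1 - real k * \<alpha>" using n by (simp add: algebra_simps)
    from holder_generator(1)[OF p _ _ this] *[of k] that show ?thesis by simp
  qed
  then show ?thesis using f by (simp add: generator_domain_pow_def)
qed

end

section \<open>The expansion of the heat loss\<close>

text \<open>
  The drop \<open>g(0) - g(y)\<close> plays two roles: its \<open>\<nu>\<close>-integral is the perimeter, and it is a modulus of
  continuity of \<open>g\<close>. Once it is integrable, \<open>g\<close> meets the criterion \<open>generates_jump_integral\<close>.
\<close>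

lemma (in finite_open_set) perimeter_eq_generator:
  assumes levy: "finite_variation_levy_measure \<nu>"
    and p: "semigroup_with_exponent p (char_exponent \<nu>)"
    and ne: "\<Omega> \<noteq> {}" and dom: "covariance \<Omega> \<in> generator_domain p"
  shows "nonlocal_perimeter \<nu> \<Omega> < \<infinity>"
    "enn2real (nonlocal_perimeter \<nu> \<Omega>) = - generator p (covariance \<Omega>) 0"
proof -
  interpret levy_jumps \<nu> by unfold_locales (rule levy)
  have pos: "0 < covariance \<Omega> 0"
  proof -
    obtain a where "a \<in> \<Omega>" using ne by blast
    then obtain e where e: "0 < e" "ball a e \<subseteq> \<Omega>" using op by (auto simp: open_contains_ball)
    have "0 < measure lborel (ball a e)" using e content_ball_pos by auto
    also have "\<dots> \<le> measure lborel \<Omega>"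
      using e Omega_fmeasurable by (intro measure_mono_fmeasurable) auto
    finally show ?thesis by (simp add: covariance_0)
  qed
  have gen: "generates p (covariance \<Omega>) (generator p (covariance \<Omega>))"
    using dom by (simp add: generator_domain_generates)
  have int: "integrable \<nu> (\<lambda>y. covariance \<Omega> 0 - covariance \<Omega> y)"
    by (rule integrable_drop_from_maximum[OF levy p gen covariance_le pos])
  have "generates p (covariance \<Omega>) (jump_integral \<nu> (covariance \<Omega>))"
    by (rule generates_jump_integral[OF p covariance_C0 int covariance_modulus])
  then have "generator p (covariance \<Omega>) = jump_integral \<nu> (covariance \<Omega>)" by (rule generates_generator)
  then have "generator p (covariance \<Omega>) 0 = (LINT y|\<nu>. - (covariance \<Omega> 0 - covariance \<Omega> y))"
    by (simp add: jump_integral_def)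
  also have "\<dots> = - (LINT y|\<nu>. covariance \<Omega> 0 - covariance \<Omega> y)"
    by (rule Bochner_Integration.integral_minus)
  finally have L: "generator p (covariance \<Omega>) 0 = - (LINT y|\<nu>. covariance \<Omega> 0 - covariance \<Omega> y)" .
  have Per: "nonlocal_perimeter \<nu> \<Omega> = ennreal (LINT y|\<nu>. covariance \<Omega> 0 - covariance \<Omega> y)"
    unfolding nonlocal_perimeter_eq[OF levy] by (rule nn_integral_eq_integral[OF int]) (simp add: covariance_le)
  then show "nonlocal_perimeter \<nu> \<Omega> < \<infinity>" by simp
  have "0 \<le> (LINT y|\<nu>. covariance \<Omega> 0 - covariance \<Omega> y)"
    by (rule integral_nonneg_AE) (simp add: covariance_le)
  then show "enn2real (nonlocal_perimeter \<nu> \<Omega>) = - generator p (covariance \<Omega>) 0"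
    by (simp add: Per L)
qed

lemma (in finite_open_set) heat_loss_expansion:
  assumes levy: "finite_variation_levy_measure \<nu>"
    and p: "semigroup_with_exponent p (char_exponent \<nu>)"
    and ne: "\<Omega> \<noteq> {}" and n: "n \<ge> 2" and dom: "covariance \<Omega> \<in> generator_domain_pow p n"
  shows "((\<lambda>t. (heat_loss p \<Omega> t - t * enn2real (nonlocal_perimeter \<nu> \<Omega>)
             + (\<Sum>k=2..n - 1. t ^ k / fact k * (generator p ^^ k) (covariance \<Omega>) 0)) / t ^ n)
        \<longlongrightarrow> - (1 / fact n) * (generator p ^^ n) (covariance \<Omega>) 0) (at_right 0)"
proof -
  have conv: "convolution_semigroup p" using p by (simp add: semigroup_with_exponent_def)
  have "covariance \<Omega> \<in> generator_domain p"
    using dom n by (auto simp: generator_domain_pow_def dest: spec[of _ 0])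
  note Per = perimeter_eq_generator(2)[OF levy p ne this]
  define L where "L k = (generator p ^^ k) (covariance \<Omega>) 0" for k
  define T where "T t = (\<Sum>k\<le>n. t ^ k / fact k * L k)" for t
  have split: "T t = covariance \<Omega> 0 + t * generator p (covariance \<Omega>) 0
      + (\<Sum>k=2..n - 1. t ^ k / fact k * L k) + t ^ n / fact n * L n" for t
  proof -
    have "{..n} = insert 0 (insert 1 (insert n {2..n - 1}))" using n by auto
    then have "T t = t ^ 0 / fact 0 * L 0 + (t ^ 1 / fact 1 * L 1 + (t ^ n / fact n * L n
        + (\<Sum>k=2..n - 1. t ^ k / fact k * L k)))"
      using n unfolding T_def by (simp only:) (subst sum.insert; simp)+
    then show ?thesis by (simp add: L_def)
  qed
  have "((\<lambda>t. (transition p t (covariance \<Omega>) 0 - T t) / t ^ n) \<longlongrightarrow> 0) (at_right 0)"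
    unfolding T_def L_def using n by (intro transition_Taylor[OF conv dom]) auto
  then have lim: "((\<lambda>t. - ((transition p t (covariance \<Omega>) 0 - T t) / t ^ n) - 1 / fact n * L n)
      \<longlongrightarrow> - 0 - 1 / fact n * L n) (at_right 0)"
    by (intro tendsto_intros)
  have "\<forall>\<^sub>F t in at_right 0. - ((transition p t (covariance \<Omega>) 0 - T t) / t ^ n) - 1 / fact n * L n =
      (heat_loss p \<Omega> t - t * enn2real (nonlocal_perimeter \<nu> \<Omega>)
             + (\<Sum>k=2..n - 1. t ^ k / fact k * L k)) / t ^ n"
    using eventually_at_right_less[of 0]
  proof eventually_elim
    case (elim t)
    have "heat_loss p \<Omega> t - t * enn2real (nonlocal_perimeter \<nu> \<Omega>) + (\<Sum>k=2..n - 1. t ^ k / fact k * L k)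
        = - (transition p t (covariance \<Omega>) 0 - T t) - t ^ n / fact n * L n"
      using elim by (simp add: heat_loss_eq[OF conv] Per split)
    moreover have "(- (transition p t (covariance \<Omega>) 0 - T t) - t ^ n / fact n * L n) / t ^ n =
      - ((transition p t (covariance \<Omega>) 0 - T t) / t ^ n) - 1 / fact n * L n"
      using elim by (simp add: diff_divide_distrib minus_divide_left)
    ultimately show ?case by simp
  qed
  from Lim_transform_eventually[OF lim this] show ?thesis by (simp add: L_def)
qed

theorem corollary2:
  fixes \<nu> :: "(real ^ 'd) measure" and p :: "real \<Rightarrow> (real ^ 'd) measure"
    and \<Omega> :: "(real ^ 'd) set" and \<alpha> C :: real and n :: nat
  assumes "finite_variation_levy_measure \<nu>"
    and "semigroup_with_exponent p (char_exponent \<nu>)"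
    and "open \<Omega>" and "\<Omega> \<noteq> {}" and "emeasure lborel \<Omega> < \<infinity>"
    and "0 < \<alpha>" and "\<alpha> < 1" and "C > 0"
    and "\<And>\<kappa> r. 0 < \<kappa> \<Longrightarrow> \<kappa> \<le> 1 \<Longrightarrow> 0 < r \<Longrightarrow> r < 1 \<Longrightarrow>
           concentration \<nu> (\<kappa> * r) \<le> C * \<kappa> powr (- \<alpha>) * concentration \<nu> r"
    and "n \<ge> 2" and "real n * \<alpha> < 1"
  shows "((\<exists>M. M-lipschitz_on UNIV (covariance \<Omega>)) \<longrightarrow>
            covariance \<Omega> \<in> generator_domain_pow p n) \<and>
         (covariance \<Omega> \<in> generator_domain_pow p n \<longrightarrow>
            nonlocal_perimeter \<nu> \<Omega> < \<infinity> \<and>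
            ((\<lambda>t. (heat_loss p \<Omega> t - t * enn2real (nonlocal_perimeter \<nu> \<Omega>)
                   + (\<Sum>k=2..n - 1. t ^ k / fact k * (generator p ^^ k) (covariance \<Omega>) 0)) / t ^ n)
              \<longlongrightarrow> - (1 / fact n) * (generator p ^^ n) (covariance \<Omega>) 0) (at_right 0))"
proof (intro conjI impI)
  interpret finite_open_set \<Omega> using assms(3,5) by unfold_locales
  interpret stable_like_jumps \<nu> \<alpha> C using assms(1,6,8,9) by unfold_locales
  show "covariance \<Omega> \<in> generator_domain_pow p n" if lip: "\<exists>M. M-lipschitz_on UNIV (covariance \<Omega>)"
  proof (rule Lipschitz_generator_domain_pow[OF assms(2) covariance_C0 _ assms(11)])
    show "holder 1 (covariance \<Omega>)"
      using lip by (auto simp: holder_def lipschitz_on_def dist_norm)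
  qed
  assume dom: "covariance \<Omega> \<in> generator_domain_pow p n"
  then have "covariance \<Omega> \<in> generator_domain p"
    using assms(10) by (auto simp: generator_domain_pow_def dest: spec[of _ 0])
  then show "nonlocal_perimeter \<nu> \<Omega> < \<infinity>"
    by (rule perimeter_eq_generator(1)[OF assms(1,2,4)])
  show "((\<lambda>t. (heat_loss p \<Omega> t - t * enn2real (nonlocal_perimeter \<nu> \<Omega>)
                   + (\<Sum>k=2..n - 1. t ^ k / fact k * (generator p ^^ k) (covariance \<Omega>) 0)) / t ^ n)
              \<longlongrightarrow> - (1 / fact n) * (generator p ^^ n) (covariance \<Omega>) 0) (at_right 0)"
    by (rule heat_loss_expansion[OF assms(1,2,4,10) dom])
qed

end
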